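(* Let $X$ be an infinite discrete space and $G=(\mathrm S(X),\tau_p)$ its permutation group with the topology of pointwise convergence. Then: (a) the Alexandroff one-point compactification $\alpha X=X\cup\{\infty\}$ is the unique $G$-compactification of $X$; (b) $e_{\alpha X}G=b_rG$ (as compactifications of $G$), and $G$ is Roelcke precompact; (c) $b_rG$ is the set of self-maps $f$ of $\alpha X$, with the topology of pointwise convergence, for which there is a subset $Y\subset X$ such that $f|_Y$ is an injection of $Y$ into $X$ and $f(\alpha X\setminus Y)=\{\infty\}$; (d) $b_rG$ is a sim-compactification of $G$, isomorphic to the symmetric inverse semigroup $I_X$, and it is the maximal sm-compactification of $G$ (the WAP-compactification of $G$).
   Context: For a compact $K$ on which $G$ acts, $e_KG$ is the closure of $\{x\mapsto gx: g\in G\}$ in $K^K$ with the product topology (a monoid under composition). The Roelcke uniformity $L\wedge R$ on $G$ has base of covers $\{OgO:g\in G\}$, $O$ a neighbourhood of $e$; $G$ is Roelcke precompact if it is totally bounded, and then the Roelcke compactification $b_rG$ is the completion of $(G,L\wedge R)$. A $G$-compactification of a $G$-space $X$ is the completion with respect to a totally bounded equiuniformity. An sm-compactification (resp. sim-compactification) of $G$ is a compactification $bG$ of $G$ with continuous extended left action of $G$ which is a semitopological monoid (resp. semitopological inverse monoid with continuous inversion) whose multiplication restricted to $G\times bG$ is the extended left action. The symmetric inverse semigroup $I_X$ is the monoid of all partial bijections between subsets of $X$ under composition. *)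

theory Defs
  imports "HOL-Analysis.Analysis"
begin

definition alexandroff :: "'a topology \<Rightarrow> 'a option topology" where
  "alexandroff T = topology (\<lambda>U. U \<subseteq> insert None (Some ` topspace T) \<and>
      (None \<notin> U \<longrightarrow> openin T (Some -` U)) \<and>
      (None \<in> U \<longrightarrow> compactin T (topspace T - Some -` U) \<and>
                     closedin T (topspace T - Some -` U)))"

definition compactification :: "'a topology \<Rightarrow> 'b topology \<Rightarrow> ('a \<Rightarrow> 'b) \<Rightarrow> bool" where
  "compactification Y K e \<longleftrightarrow> compact_space K \<and> Hausdorff_space K \<and> embedding_map Y K e
     \<and> K closure_of (e ` topspace Y) = topspace K"

definition equiv_compactification ::
  "'a topology \<Rightarrow> 'b topology \<Rightarrow> ('a \<Rightarrow> 'b) \<Rightarrow> 'c topology \<Rightarrow> ('a \<Rightarrow> 'c) \<Rightarrow> bool" where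
  "equiv_compactification Y K1 e1 K2 e2 \<longleftrightarrow>
     (\<exists>h. homeomorphic_map K1 K2 h \<and> (\<forall>y\<in>topspace Y. h (e1 y) = e2 y))"

definition G_compactification ::
  "'g topology \<Rightarrow> ('g \<Rightarrow> 'x \<Rightarrow> 'x) \<Rightarrow> 'x topology \<Rightarrow> 'k topology \<Rightarrow> ('x \<Rightarrow> 'k)
     \<Rightarrow> ('g \<Rightarrow> 'k \<Rightarrow> 'k) \<Rightarrow> bool" where
  "G_compactification Gtop act X K e \<alpha> \<longleftrightarrow> compactification X K e
     \<and> continuous_map (prod_topology Gtop K) K (\<lambda>(g,y). \<alpha> g y)
     \<and> (\<forall>g\<in>topspace Gtop. \<forall>x\<in>topspace X. \<alpha> g (e x) = e (act g x))"

definition dbl :: "('g \<Rightarrow> 'g \<Rightarrow> 'g) \<Rightarrow> 'g set \<Rightarrow> 'g \<Rightarrow> 'g set" where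
  "dbl gmul U g = {gmul (gmul a g) b | a b. a \<in> U \<and> b \<in> U}"

text \<open>Roelcke precompactness: the Roelcke uniformity (base of covers {OgO}) is totally bounded.\<close>
definition roelcke_precompact :: "'g topology \<Rightarrow> ('g \<Rightarrow> 'g \<Rightarrow> 'g) \<Rightarrow> 'g \<Rightarrow> bool" where
  "roelcke_precompact Gtop gmul one \<longleftrightarrow>
     (\<forall>U. openin Gtop U \<and> one \<in> U \<longrightarrow>
        (\<exists>F. finite F \<and> F \<subseteq> topspace Gtop \<and> topspace Gtop = \<Union> (dbl gmul U ` F)))"

text \<open>(K,e) is (a copy of) the Roelcke compactification b_r G: a compactification of G
  such that the unique uniformity of K (the neighbourhoods of the diagonal) induces on G
  exactly the Roelcke uniformity L \<and> R, whose entourages are generated by the sets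
  \<Union>g. OgO \<times> OgO, U a neighbourhood of the identity.  I.e. K is the completion
  of (G, L \<and> R).\<close>
definition roelcke_compactification ::
  "'g topology \<Rightarrow> ('g \<Rightarrow> 'g \<Rightarrow> 'g) \<Rightarrow> 'g \<Rightarrow> 'k topology \<Rightarrow> ('g \<Rightarrow> 'k) \<Rightarrow> bool" where
  "roelcke_compactification Gtop gmul one K e \<longleftrightarrow> compactification Gtop K e
     \<and> (\<forall>W. openin (prod_topology K K) W \<and> (\<forall>z\<in>topspace K. (z,z) \<in> W) \<longrightarrow>
          (\<exists>U. openin Gtop U \<and> one \<in> U \<and>
             (\<forall>g\<in>topspace Gtop. \<forall>a\<in>dbl gmul U g. \<forall>b\<in>dbl gmul U g. (e a, e b) \<in> W)))
     \<and> (\<forall>U. openin Gtop U \<and> one \<in> U \<longrightarrow>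
          (\<exists>W. openin (prod_topology K K) W \<and> (\<forall>z\<in>topspace K. (z,z) \<in> W) \<and>
             (\<forall>a\<in>topspace Gtop. \<forall>b\<in>topspace Gtop. (e a, e b) \<in> W \<longrightarrow>
                (\<exists>g\<in>topspace Gtop. a \<in> dbl gmul U g \<and> b \<in> dbl gmul U g))))"

definition env_top :: "'k topology \<Rightarrow> ('g \<Rightarrow> 'k \<Rightarrow> 'k) \<Rightarrow> 'g set \<Rightarrow> ('k \<Rightarrow> 'k) topology" where
  "env_top K \<alpha> G = subtopology (product_topology (\<lambda>_. K) (topspace K))
      ((product_topology (\<lambda>_. K) (topspace K)) closure_of
         ((\<lambda>g. restrict (\<alpha> g) (topspace K)) ` G))"

definition env_map :: "'k topology \<Rightarrow> ('g \<Rightarrow> 'k \<Rightarrow> 'k) \<Rightarrow> 'g \<Rightarrow> ('k \<Rightarrow> 'k)" where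
  "env_map K \<alpha> g = restrict (\<alpha> g) (topspace K)"

definition sm_compactification ::
  "'g topology \<Rightarrow> ('g \<Rightarrow> 'g \<Rightarrow> 'g) \<Rightarrow> 'k topology \<Rightarrow> ('g \<Rightarrow> 'k) \<Rightarrow> ('k \<Rightarrow> 'k \<Rightarrow> 'k) \<Rightarrow> bool" where
  "sm_compactification Gtop gmul K e m \<longleftrightarrow> compactification Gtop K e
     \<and> (\<forall>x\<in>topspace K. \<forall>y\<in>topspace K. m x y \<in> topspace K)
     \<and> (\<forall>x\<in>topspace K. \<forall>y\<in>topspace K. \<forall>z\<in>topspace K. m (m x y) z = m x (m y z))
     \<and> (\<exists>u\<in>topspace K. \<forall>x\<in>topspace K. m u x = x \<and> m x u = x)
     \<and> (\<forall>a\<in>topspace K. continuous_map K K (m a) \<and> continuous_map K K (\<lambda>x. m x a))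
     \<and> continuous_map (prod_topology Gtop K) K (\<lambda>(g,y). m (e g) y)
     \<and> (\<forall>g\<in>topspace Gtop. \<forall>h\<in>topspace Gtop. m (e g) (e h) = e (gmul g h))"

definition is_inverse_of :: "('k \<Rightarrow> 'k \<Rightarrow> 'k) \<Rightarrow> 'k set \<Rightarrow> 'k \<Rightarrow> 'k \<Rightarrow> bool" where
  "is_inverse_of m S s t \<longleftrightarrow> t \<in> S \<and> m (m s t) s = s \<and> m (m t s) t = t"

definition sim_compactification ::
  "'g topology \<Rightarrow> ('g \<Rightarrow> 'g \<Rightarrow> 'g) \<Rightarrow> 'k topology \<Rightarrow> ('g \<Rightarrow> 'k) \<Rightarrow> ('k \<Rightarrow> 'k \<Rightarrow> 'k) \<Rightarrow> bool" where
  "sim_compactification Gtop gmul K e m \<longleftrightarrow> sm_compactification Gtop gmul K e m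
     \<and> (\<forall>s\<in>topspace K. \<exists>!t. is_inverse_of m (topspace K) s t)
     \<and> continuous_map K K (\<lambda>s. THE t. is_inverse_of m (topspace K) s t)"

definition sym_inverse_semigroup :: "'a set \<Rightarrow> ('a \<rightharpoonup> 'a) set" where
  "sym_inverse_semigroup X = {f. dom f \<subseteq> X \<and> ran f \<subseteq> X \<and> inj_on f (dom f)}"

definition monoid_iso_to_IX ::
  "'k set \<Rightarrow> ('k \<Rightarrow> 'k \<Rightarrow> 'k) \<Rightarrow> 'a set \<Rightarrow> ('k \<Rightarrow> ('a \<rightharpoonup> 'a)) \<Rightarrow> bool" where
  "monoid_iso_to_IX S m X \<phi> \<longleftrightarrow> bij_betw \<phi> S (sym_inverse_semigroup X)
     \<and> (\<forall>s\<in>S. \<forall>t\<in>S. \<phi> (m s t) = \<phi> s \<circ>\<^sub>m \<phi> t)"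

definition perm_top :: "('a \<Rightarrow> 'a) topology" where
  "perm_top = subtopology (product_topology (\<lambda>_. discrete_topology UNIV) UNIV) {f. bij f}"

abbreviation alphaX :: "'a option topology" where
  "alphaX \<equiv> alexandroff (discrete_topology (UNIV :: 'a set))"

definition pinj_maps :: "('a option \<Rightarrow> 'a option) set" where
  "pinj_maps = {f. \<exists>Y :: 'a set. inj_on f (Some ` Y) \<and> f ` (Some ` Y) \<subseteq> Some ` UNIV
                     \<and> f ` (UNIV - Some ` Y) = {None}}"

end

theory Submission
  imports Defs
begin

text \<open>
  A point \<open>z\<close> of the closure of the permutation group in the self-maps of \<open>\<alpha>X\<close> is a partial
  injection of \<open>X\<close>, and its basic neighbourhoods consist of the maps with the same graph as \<open>z\<close>
  inside \<open>F \<times> F\<close>, for finite \<open>F \<subseteq> X\<close>. Two permutations have the same graph inside \<open>F \<times> F\<close>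
  exactly when they lie in the same double coset of the pointwise stabiliser of \<open>F\<close>; hence the
  compact space of partial injections, in which the permutations are dense, induces the Roelcke
  uniformity.

  For maximality, let \<open>u\<close> be a continuous real function on an sm-compactification. If \<open>u\<close>
  oscillated near \<open>z\<close>, there would be permutations \<open>g i\<close> with the graph of \<open>z\<close> on ever larger finite
  sets, and \<open>t i\<close> fixing these sets, with \<open>u (g i \<circ> t i)\<close> far from \<open>u (g i)\<close>. For the products
  \<open>h j = t 0 \<circ> \<dots> \<circ> t (j - 1)\<close>, the value \<open>u (g i \<circ> h j)\<close> is close to \<open>u (g i)\<close> when \<open>i \<ge> j\<close> and to
  \<open>u (g i \<circ> t i)\<close> when \<open>i < j\<close>, which contradicts the double limit property of separately continuous
  functions on compact spaces.
\<close>

section \<open>Compact spaces\<close>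

lemma closedin_euclidean_preimage:
  fixes f :: "'k \<Rightarrow> 'b::topological_space"
  assumes "continuous_map K euclidean f" and "closed S"
  shows "closedin K {x \<in> topspace K. f x \<in> S}"
  using closedin_continuous_map_preimage[OF assms(1)] assms(2) by simp

lemma compact_space_cluster_point:
  assumes "compact_space K" and "F \<noteq> bot" and "eventually (\<lambda>i. x i \<in> topspace K) F"
  obtains c where "c \<in> topspace K"
    and "\<And>C. closedin K C \<Longrightarrow> eventually (\<lambda>i. x i \<in> C) F \<Longrightarrow> c \<in> C"
proof -
  let ?\<C> = "{C. closedin K C \<and> eventually (\<lambda>i. x i \<in> C) F}"
  have "\<Inter>\<F> \<noteq> {}" if "finite \<F>" and "\<F> \<subseteq> ?\<C>" for \<F>
  proof -
    have "eventually (\<lambda>i. \<forall>C\<in>\<F>. x i \<in> C) F"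
      using that by (intro eventually_ball_finite) auto
    then obtain i where "\<forall>C\<in>\<F>. x i \<in> C"
      using eventually_happens'[OF assms(2)] by blast
    then show ?thesis by blast
  qed
  then have "\<Inter>?\<C> \<noteq> {}"
    using assms(1) unfolding compact_space_fip by simp
  then obtain c where "c \<in> \<Inter>?\<C>" by blast
  moreover have "topspace K \<in> ?\<C>" using assms(3) by simp
  ultimately show thesis by (intro that[of c]) blast+
qed

lemma separately_continuous_double_limit:
  fixes \<phi> :: "'k \<Rightarrow> 'l \<Rightarrow> real"
  assumes "compact_space K" and "compact_space L"
    and cont_fst: "\<And>y. y \<in> topspace L \<Longrightarrow> continuous_map K euclideanreal (\<lambda>x. \<phi> x y)"
    and cont_snd: "\<And>x. x \<in> topspace K \<Longrightarrow> continuous_map L euclideanreal (\<phi> x)"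
    and "F \<noteq> bot" and "G \<noteq> bot"
    and x: "\<And>i. x i \<in> topspace K" and y: "\<And>j. y j \<in> topspace L"
    and le: "\<And>j. eventually (\<lambda>i. \<phi> (x i) (y j) \<le> a) F"
    and ge: "\<And>i. eventually (\<lambda>j. b \<le> \<phi> (x i) (y j)) G"
  shows "b \<le> a"
proof -
  obtain c where c: "c \<in> topspace K"
    and c_cluster: "\<And>C. closedin K C \<Longrightarrow> eventually (\<lambda>i. x i \<in> C) F \<Longrightarrow> c \<in> C"
    using compact_space_cluster_point[OF assms(1,5), of x] x by auto
  obtain d where d: "d \<in> topspace L"
    and d_cluster: "\<And>C. closedin L C \<Longrightarrow> eventually (\<lambda>j. y j \<in> C) G \<Longrightarrow> d \<in> C"
    using compact_space_cluster_point[OF assms(2,6), of y] y by auto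
  have "\<phi> c (y j) \<le> a" for j
    using c_cluster[OF closedin_euclidean_preimage[OF cont_fst[OF y], of "{..a}"]] le x by simp
  then have "\<phi> c d \<le> a"
    using d_cluster[OF closedin_euclidean_preimage[OF cont_snd[OF c], of "{..a}"]] y by simp
  have "b \<le> \<phi> (x i) d" for i
    using d_cluster[OF closedin_euclidean_preimage[OF cont_snd[OF x], of "{b..}"]] ge y by simp
  then have "b \<le> \<phi> c d"
    using c_cluster[OF closedin_euclidean_preimage[OF cont_fst[OF d], of "{b..}"]] x by simp
  with \<open>\<phi> c d \<le> a\<close> show ?thesis by simp
qed

lemma limitin_if_real_images_Cauchy:
  assumes "compact_space K" and "Hausdorff_space K" and "F \<noteq> bot"
    and f: "eventually (\<lambda>x. f x \<in> topspace K) F"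
    and Cauchy: "\<And>u \<epsilon>::real. continuous_map K euclideanreal u \<Longrightarrow> 0 < \<epsilon> \<Longrightarrow>
      \<exists>P. eventually P F \<and> (\<forall>a b. P a \<longrightarrow> P b \<longrightarrow> \<bar>u (f a) - u (f b)\<bar> \<le> \<epsilon>)"
  obtains c where "limitin K f c F"
proof -
  have "completely_regular_space K"
    using assms(1,2)
    by (simp add: normal_imp_completely_regular_space compact_Hausdorff_or_regular_imp_normal_space)
  obtain c where c: "c \<in> topspace K"
    and cluster: "\<And>C. closedin K C \<Longrightarrow> eventually (\<lambda>x. f x \<in> C) F \<Longrightarrow> c \<in> C"
    using compact_space_cluster_point[OF assms(1,3) f] by blast
  have "eventually (\<lambda>x. f x \<in> U) F" if U: "openin K U" "c \<in> U" for U
  proof -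
    obtain u where u: "continuous_map K euclideanreal u" "u c = 0" "u ` (topspace K - U) \<subseteq> {1}"
      using \<open>completely_regular_space K\<close>[unfolded completely_regular_space_alt', rule_format, OF U]
      by blast
    obtain P where P: "eventually P F" "\<And>a b. P a \<Longrightarrow> P b \<Longrightarrow> \<bar>u (f a) - u (f b)\<bar> \<le> 1 / 2"
      using Cauchy[OF u(1), of "1 / 2"] by auto
    have "\<bar>u (f a)\<bar> \<le> 1 / 2" if "P a" for a
    proof -
      have "closedin K {y \<in> topspace K. \<bar>u (f a) - u y\<bar> \<in> {..1 / 2}}"
        using u(1)
        by (intro closedin_euclidean_preimage continuous_map_real_abs continuous_map_diff) auto
      moreover have "eventually (\<lambda>b. f b \<in> {y \<in> topspace K. \<bar>u (f a) - u y\<bar> \<in> {..1 / 2}}) F"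
        using f P(1) by eventually_elim (use P(2) that in auto)
      ultimately have "c \<in> {y \<in> topspace K. \<bar>u (f a) - u y\<bar> \<in> {..1 / 2}}"
        by (rule cluster)
      with u(2) show ?thesis by simp
    qed
    then have "f a \<in> U" if "P a" and "f a \<in> topspace K" for a
      using u(3) that by (cases "f a \<in> U") (fastforce simp: image_subset_iff)+
    with P(1) f show ?thesis by (auto elim: eventually_elim2)
  qed
  with c have "limitin K f c F" by (simp add: limitin_def)
  then show thesis by (rule that)
qed

lemma continuous_map_extension_if_small_oscillation:
  assumes K: "compact_space K" "Hausdorff_space K"
    and S: "S \<subseteq> topspace X" "X closure_of S = topspace X"
    and f: "continuous_map (subtopology X S) K f"
    and oscillation: "\<And>z u \<epsilon>::real. z \<in> topspace X - S \<Longrightarrow> continuous_map K euclideanreal u \<Longrightarrow> 0 < \<epsilon> \<Longrightarrow>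
      \<exists>V. openin X V \<and> z \<in> V \<and> (\<forall>a\<in>V \<inter> S. \<forall>b\<in>V \<inter> S. \<bar>u (f a) - u (f b)\<bar> \<le> \<epsilon>)"
  obtains h where "continuous_map X K h" and "\<And>x. x \<in> S \<Longrightarrow> h x = f x"
proof -
  have "\<exists>c. limitin K f c (atin_within X z S)" if z: "z \<in> topspace X - S" for z
  proof (rule limitin_if_real_images_Cauchy[OF K])
    show "atin_within X z S \<noteq> bot"
      using z S(2) derived_set_of_trivial_limit[of z X S] by (auto simp: closure_of)
    show "eventually (\<lambda>x. f x \<in> topspace K) (atin_within X z S)"
      using z S(1) continuous_map_funspace[OF f]
      by (fastforce simp: eventually_atin_within intro: exI[of _ "topspace X"])
    fix u and \<epsilon> :: real assume "continuous_map K euclideanreal u" and "0 < \<epsilon>"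
    from oscillation[OF z this] obtain V where "openin X V" "z \<in> V"
      and "\<forall>a\<in>V \<inter> S. \<forall>b\<in>V \<inter> S. \<bar>u (f a) - u (f b)\<bar> \<le> \<epsilon>" by blast
    then show "\<exists>P. eventually P (atin_within X z S) \<and> (\<forall>a b. P a \<longrightarrow> P b \<longrightarrow> \<bar>u (f a) - u (f b)\<bar> \<le> \<epsilon>)"
      by (intro exI[of _ "\<lambda>x. x \<in> V \<inter> S"]) (auto simp: eventually_atin_within)
  qed blast
  then obtain h where "continuous_map (subtopology X (topspace X)) K h" "\<And>x. x \<in> S \<Longrightarrow> h x = f x"
    using continuous_map_extension_pointwise_alt[of K S "topspace X" X f] K S f
    by (auto simp: compact_Hausdorff_imp_regular_space)
  then show thesis using that by simp
qed


section \<open>Compactifications with a group action\<close>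

lemma compactification_imp_continuous_map:
  assumes "compactification Y K e"
  shows "continuous_map Y K e"
  using assms homeomorphic_imp_continuous_map[of Y "subtopology K (e ` topspace Y)" e]
  by (simp add: compactification_def embedding_map_def continuous_map_in_subtopology)

lemma compactification_remainder_approximable:
  assumes c: "compactification Y K e" and z: "z \<in> topspace K - e ` topspace Y"
    and U: "openin K U" "z \<in> U" and F: "finite F"
  obtains x where "x \<in> topspace Y - F" "e x \<in> U"
proof -
  have "Hausdorff_space K" and dense: "K closure_of (e ` topspace Y) = topspace K"
    using c by (simp_all add: compactification_def)
  then have "closedin K (e ` (topspace Y \<inter> F))"
    using F continuous_map_image_subset_topspace[OF compactification_imp_continuous_map[OF c]]
    by (intro closedin_Hausdorff_finite) auto
  then have "openin K (U - e ` (topspace Y \<inter> F))" using U(1) by (rule openin_diff[rotated])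
  moreover have "z \<in> U - e ` (topspace Y \<inter> F)" using z U(2) by auto
  moreover have "z \<in> K closure_of (e ` topspace Y)" using z dense by simp
  ultimately obtain w where "w \<in> e ` topspace Y" "w \<in> U - e ` (topspace Y \<inter> F)"
    unfolding in_closure_of by meson
  then show thesis using that by blast
qed

lemma compactification_remainder_nonempty:
  assumes "compactification Y K e" and "\<not> compact_space Y"
  shows "topspace K - e ` topspace Y \<noteq> {}"
proof
  assume "topspace K - e ` topspace Y = {}"
  moreover have hom: "homeomorphic_map Y (subtopology K (e ` topspace Y)) e" and "compact_space K"
    using assms(1) by (simp_all add: compactification_def embedding_map_def)
  ultimately have "compact_space (subtopology K (e ` topspace Y))"
    by (metis Diff_eq_empty_iff inf.absorb_iff1 subtopology_restrict subtopology_topspace)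
  then show False
    using homeomorphic_compact_space[OF homeomorphic_map_imp_homeomorphic_space[OF hom]] assms(2)
    by blast
qed

lemma G_compactification_one:
  assumes G: "G_compactification Gtop act X K e \<alpha>" and one: "one \<in> topspace Gtop"
    and act_one: "\<And>x. x \<in> topspace X \<Longrightarrow> act one x = x" and z: "z \<in> topspace K"
  shows "\<alpha> one z = z"
proof (rule forall_in_closure_of_eq[where f = "\<alpha> one" and g = "\<lambda>z. z"])
  show "z \<in> K closure_of (e ` topspace X)" "Hausdorff_space K"
    using G z by (simp_all add: G_compactification_def compactification_def)
  have "continuous_map K (prod_topology Gtop K) (\<lambda>z. (one, z))"
    using one by (simp add: continuous_map_pairwise comp_def)
  then have "continuous_map K K ((\<lambda>(g, y). \<alpha> g y) \<circ> (\<lambda>z. (one, z)))"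
    using G by (intro continuous_map_compose) (auto simp: G_compactification_def)
  then show "continuous_map K K (\<alpha> one)" by (simp add: comp_def)
  show "\<alpha> one x = x" if "x \<in> e ` topspace X" for x
    using that G one act_one by (auto simp: G_compactification_def)
qed simp

lemma G_compactification_small_displacement:
  assumes G: "G_compactification Gtop act X K e \<alpha>" and one: "one \<in> topspace Gtop"
    and act_one: "\<And>x. x \<in> topspace X \<Longrightarrow> act one x = x"
    and u: "continuous_map K euclideanreal u" and "0 < (\<epsilon>::real)"
  obtains U where "openin Gtop U" "one \<in> U"
    "\<And>g y. g \<in> U \<Longrightarrow> y \<in> topspace K \<Longrightarrow> \<bar>u (\<alpha> g y) - u y\<bar> < \<epsilon>"
proof -
  let ?f = "\<lambda>p. \<bar>u (case p of (g, y) \<Rightarrow> \<alpha> g y) - u (snd p)\<bar>"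
  let ?W = "{p \<in> topspace (prod_topology Gtop K). ?f p \<in> {..<\<epsilon>}}"
  have K: "compact_space K" and cont: "continuous_map (prod_topology Gtop K) K (\<lambda>(g, y). \<alpha> g y)"
    using G by (simp_all add: G_compactification_def compactification_def)
  have "continuous_map (prod_topology Gtop K) euclideanreal ?f"
    using continuous_map_compose[OF cont u] continuous_map_compose[OF continuous_map_snd u]
    by (intro continuous_map_real_abs continuous_map_diff) (simp_all add: comp_def)
  then have "openin (prod_topology Gtop K) ?W"
    by (rule openin_continuous_map_preimage) simp
  moreover have "{one} \<times> topspace K \<subseteq> ?W"
    using G_compactification_one[OF G one act_one] one \<open>0 < \<epsilon>\<close> by auto
  ultimately obtain U V where "openin Gtop U" "one \<in> U" and "topspace K \<subseteq> V" "U \<times> V \<subseteq> ?W"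
    using tube_lemma_right[of Gtop K ?W "topspace K" one] K one by (auto simp: compact_space_def)
  then show thesis by (intro that[of U]) (simp_all add: subset_iff)
qed

lemma G_compactification_remainder_unique:
  assumes G: "G_compactification Gtop act X K e \<alpha>" and one: "one \<in> topspace Gtop"
    and act_one: "\<And>x. x \<in> topspace X \<Longrightarrow> act one x = x"
    and transitive: "\<And>U. openin Gtop U \<Longrightarrow> one \<in> U \<Longrightarrow>
      \<exists>F. finite F \<and> (\<forall>x\<in>topspace X - F. \<forall>y\<in>topspace X - F. \<exists>g\<in>U. act g x = y)"
    and p: "p \<in> topspace K - e ` topspace X" and q: "q \<in> topspace K - e ` topspace X"
  shows "p = q"
proof (rule ccontr)
  assume "p \<noteq> q"
  have c: "compactification X K e" and "Hausdorff_space K"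
    and cont: "continuous_map (prod_topology Gtop K) K (\<lambda>(g, y). \<alpha> g y)"
    and equivariant: "\<And>g x. g \<in> topspace Gtop \<Longrightarrow> x \<in> topspace X \<Longrightarrow> \<alpha> g (e x) = e (act g x)"
    using G by (simp_all add: G_compactification_def compactification_def)
  obtain A B where AB: "openin K A" "openin K B" "p \<in> A" "q \<in> B" "disjnt A B"
    using \<open>Hausdorff_space K\<close>[unfolded Hausdorff_space_def, rule_format, of p q] p q \<open>p \<noteq> q\<close> by auto
  let ?W = "{s \<in> topspace (prod_topology Gtop K). (case s of (g, y) \<Rightarrow> \<alpha> g y) \<in> A}"
  have "openin (prod_topology Gtop K) ?W"
    using cont AB(1) by (rule openin_continuous_map_preimage)
  moreover have "(one, p) \<in> ?W"
    using G_compactification_one[OF G one act_one] one p AB(3) by simp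
  ultimately obtain U P where UP: "openin Gtop U" "openin K P" "one \<in> U" "p \<in> P" "U \<times> P \<subseteq> ?W"
    unfolding openin_prod_topology_alt by meson
  obtain F where F: "finite F" "\<And>x y. x \<in> topspace X - F \<Longrightarrow> y \<in> topspace X - F \<Longrightarrow> \<exists>g\<in>U. act g x = y"
    using transitive[OF UP(1,3)] by blast
  obtain x where x: "x \<in> topspace X - F" "e x \<in> P"
    using compactification_remainder_approximable[OF c p UP(2,4) F(1)] .
  obtain y where y: "y \<in> topspace X - F" "e y \<in> B"
    using compactification_remainder_approximable[OF c q AB(2,4) F(1)] .
  obtain g where g: "g \<in> U" "act g x = y" using F(2)[OF x(1) y(1)] by blast
  then have "\<alpha> g (e x) \<in> A" "g \<in> topspace Gtop" using UP(5) x(2) by auto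
  then have "e y \<in> A" using equivariant[of g x] x(1) g(2) by simp
  with y(2) AB(5) show False by (auto simp: disjnt_def)
qed


section \<open>The one-point compactification\<close>

lemma openin_alexandroff:
  "openin (alexandroff T) U \<longleftrightarrow> U \<subseteq> insert None (Some ` topspace T) \<and>
      (None \<notin> U \<longrightarrow> openin T (Some -` U)) \<and>
      (None \<in> U \<longrightarrow> compactin T (topspace T - Some -` U) \<and> closedin T (topspace T - Some -` U))"
  (is "_ \<longleftrightarrow> ?open U")
  and alexandroff_eq_Alexandroff_compactification: "alexandroff T = Alexandroff_compactification T"
proof -
  have open_imp: "openin (Alexandroff_compactification T) U" if U: "?open U" for U
  proof (cases "None \<in> U")
    case True
    then have "U = insert None (Some ` (topspace T - (topspace T - Some -` U)))"
      using U by (auto simp: image_iff)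
    then show ?thesis using U True by (auto simp: openin_Alexandroff_compactification)
  next
    case False
    then have "U = Some ` (Some -` U)" using U by auto
    then show ?thesis using U False by (metis openin_Alexandroff_compactification)
  qed
  have imp_open: "?open U" if "openin (Alexandroff_compactification T) U" for U
    using that unfolding openin_Alexandroff_compactification
  proof (elim disjE exE conjE)
    fix V assume "openin T V" "U = Some ` V"
    then show ?thesis using openin_subset[of T V] by (auto simp: inj_vimage_image_eq)
  next
    fix C assume C: "compactin T C" "closedin T C" "U = insert None (Some ` (topspace T - C))"
    then have "topspace T - Some -` U = C" using closedin_subset[of T C] by auto
    with C show ?thesis by auto
  qed
  have open_eq: "?open = openin (Alexandroff_compactification T)"
    by (rule ext, rule iffI) (erule open_imp, erule imp_open)
  then show eq: "alexandroff T = Alexandroff_compactification T"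
    unfolding alexandroff_def by (simp add: openin_inverse)
  show "openin (alexandroff T) U \<longleftrightarrow> ?open U"
    unfolding eq by (rule fun_cong[OF open_eq, symmetric])
qed

lemma topspace_alexandroff: "topspace (alexandroff T) = insert None (Some ` topspace T)"
  by (simp add: alexandroff_eq_Alexandroff_compactification)

lemma continuous_map_alexandroff_case_option:
  assumes f: "continuous_map Y K f" and r: "r \<in> topspace K"
    and compact: "\<And>U. openin K U \<Longrightarrow> r \<in> U \<Longrightarrow> compactin Y {y \<in> topspace Y. f y \<notin> U}"
  shows "continuous_map (alexandroff Y) K (case_option r f)"
  unfolding continuous_map_def
proof (intro conjI allI impI)
  show "case_option r f \<in> topspace (alexandroff Y) \<rightarrow> topspace K"
    using r continuous_map_image_subset_topspace[OF f] by (auto simp: topspace_alexandroff)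
  fix U assume U: "openin K U"
  let ?V = "{w \<in> topspace (alexandroff Y). case_option r f w \<in> U}"
  have vimage: "Some -` ?V = {y \<in> topspace Y. f y \<in> U}" by (auto simp: topspace_alexandroff)
  have diff: "topspace Y - Some -` ?V = {y \<in> topspace Y. f y \<notin> U}" unfolding vimage by blast
  have "openin Y (Some -` ?V)"
    unfolding vimage by (rule openin_continuous_map_preimage[OF f U])
  then have "closedin Y (topspace Y - Some -` ?V)" by (intro closedin_diff closedin_topspace)
  moreover have "compactin Y (topspace Y - Some -` ?V)" if "r \<in> U"
    unfolding diff using compact[OF U that] .
  ultimately show "openin (alexandroff Y) ?V"
    using \<open>openin Y (Some -` ?V)\<close> by (auto simp: openin_alexandroff topspace_alexandroff)
qed

lemma equiv_compactification_alexandroff: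
  assumes c: "compactification Y K e" and r: "topspace K - e ` topspace Y = {r}"
  shows "equiv_compactification Y (alexandroff Y) Some K e"
proof -
  have K: "compact_space K" "Hausdorff_space K"
    and hom: "homeomorphic_map Y (subtopology K (e ` topspace Y)) e"
    using c by (simp_all add: compactification_def embedding_map_def)
  have e: "continuous_map Y K e" and inj: "inj_on e (topspace Y)"
    using compactification_imp_continuous_map[OF c] homeomorphic_imp_injective_map[OF hom] .
  have sub: "e ` topspace Y \<subseteq> topspace K" using continuous_map_image_subset_topspace[OF e] .
  have "compactin Y {y \<in> topspace Y. e y \<notin> U}" if U: "openin K U" "r \<in> U" for U
  proof -
    have image: "e ` {y \<in> topspace Y. e y \<notin> U} = topspace K - U"
      using sub r U(2) by auto
    have "compactin K (topspace K - U)"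
      using K(1) U(1) by (intro closedin_compact_space) auto
    then have "compactin (subtopology K (e ` topspace Y)) (e ` {y \<in> topspace Y. e y \<notin> U})"
      by (auto simp: compactin_subtopology simp flip: image)
    then show ?thesis
      using homeomorphic_map_compactness[OF hom, of "{y \<in> topspace Y. e y \<notin> U}"] by simp
  qed
  then have "continuous_map (alexandroff Y) K (case_option r e)"
    using r by (intro continuous_map_alexandroff_case_option[OF e]) auto
  moreover have "case_option r e ` topspace (alexandroff Y) = topspace K"
    using r sub unfolding topspace_alexandroff by (auto simp: image_image)
  moreover have "inj_on (case_option r e) (topspace (alexandroff Y))"
    using inj r by (auto simp: topspace_alexandroff inj_on_def)
  ultimately have "homeomorphic_map (alexandroff Y) K (case_option r e)"
    by (intro continuous_imp_homeomorphic_map)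
      (simp_all add: K alexandroff_eq_Alexandroff_compactification)
  then show ?thesis
    unfolding equiv_compactification_def by (intro exI[of _ "case_option r e"]) simp
qed


section \<open>The one-point compactification of a discrete space\<close>

lemma openin_alphaX: "openin alphaX U \<longleftrightarrow> (None \<in> U \<longrightarrow> finite (- Some -` U))"
  by (simp add: openin_alexandroff compactin_discrete_topology Compl_eq_Diff_UNIV
      flip: UNIV_option_conv)

lemma topspace_alphaX [simp]: "topspace alphaX = UNIV"
  by (simp add: topspace_alexandroff UNIV_option_conv)

lemma compact_space_alphaX: "compact_space alphaX"
  and Hausdorff_space_alphaX: "Hausdorff_space alphaX"
  by (simp_all add: alexandroff_eq_Alexandroff_compactification
      Hausdorff_space_Alexandroff_compactification locally_compact_space_discrete_topology)

lemma clopen_alphaX_Some: "openin alphaX {Some y}" "closedin alphaX {Some y}"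
  by (simp_all add: openin_alphaX closedin_Hausdorff_singleton Hausdorff_space_alphaX)

lemma continuous_map_into_alphaX_iff:
  "continuous_map S alphaX f \<longleftrightarrow>
    (\<forall>y. openin S {s \<in> topspace S. f s = Some y} \<and> closedin S {s \<in> topspace S. f s = Some y})"
  (is "_ \<longleftrightarrow> ?clopen_fibres")
proof
  show ?clopen_fibres if f: "continuous_map S alphaX f"
    using openin_continuous_map_preimage[OF f clopen_alphaX_Some(1)]
      closedin_continuous_map_preimage[OF f clopen_alphaX_Some(2)] by simp
next
  assume clopen: ?clopen_fibres
  have fibres: "{s \<in> topspace S. f s \<in> Some ` A} = (\<Union>y\<in>A. {s \<in> topspace S. f s = Some y})" for A
    by auto
  show "continuous_map S alphaX f"
    unfolding continuous_map_def
  proof (intro conjI allI impI)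
    fix U :: "'b option set" assume U: "openin alphaX U"
    show "openin S {s \<in> topspace S. f s \<in> U}"
    proof (cases "None \<in> U")
      case True
      then have "w \<in> U \<longleftrightarrow> w \<notin> Some ` (- Some -` U)" for w by (cases w) auto
      then have "{s \<in> topspace S. f s \<in> U} = topspace S - {s \<in> topspace S. f s \<in> Some ` (- Some -` U)}"
        by blast
      moreover have "closedin S {s \<in> topspace S. f s \<in> Some ` (- Some -` U)}"
        unfolding fibres using U True clopen by (intro closedin_Union) (auto simp: openin_alphaX)
      ultimately show ?thesis by (simp only: openin_diff openin_topspace)
    next
      case False
      then have "w \<in> U \<longleftrightarrow> w \<in> Some ` (Some -` U)" for w by (cases w) auto
      then have "{s \<in> topspace S. f s \<in> U} = {s \<in> topspace S. f s \<in> Some ` (Some -` U)}"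
        by blast
      moreover have "openin S {s \<in> topspace S. f s \<in> Some ` (Some -` U)}"
        unfolding fibres using clopen by (intro openin_Union) auto
      ultimately show ?thesis by (simp only:)
    qed
  qed simp
qed


section \<open>Permutations\<close>

lemma finite_inj_on_extends_to_permutation:
  assumes "finite A" and "inj_on q A"
  obtains h where "bij h" "finite {x. h x \<noteq> x}" "\<And>x. x \<in> A \<Longrightarrow> h x = q x"
proof -
  let ?S = "A \<union> q ` A"
  have "card (?S - A) = card (?S - q ` A)"
    using assms by (simp add: card_Diff_subset card_image)
  then obtain r where "bij_betw r (?S - A) (?S - q ` A)"
    using finite_same_card_bij[of "?S - A" "?S - q ` A"] assms(1) by auto
  from bij_betw_disjoint_Un[OF inj_on_imp_bij_betw[OF assms(2)] this]
  have "bij_betw (\<lambda>x. if x \<in> A then q x else r x) (A \<union> (?S - A)) (q ` A \<union> (?S - q ` A))"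
    by blast
  moreover have "A \<union> (?S - A) = ?S" "q ` A \<union> (?S - q ` A) = ?S" by auto
  ultimately have "bij_betw (\<lambda>x. if x \<in> A then q x else r x) ?S ?S" by (simp only:)
  note bij_betw_disjoint_Un[OF this bij_betw_id[of "- ?S"]]
  moreover define h where "h x = (if x \<in> ?S then (if x \<in> A then q x else r x) else id x)" for x
  ultimately have "bij h"
    by (simp only: h_def[abs_def] Compl_partition Compl_disjoint simp_thms)
  moreover have "{x. h x \<noteq> x} \<subseteq> ?S" unfolding h_def by auto
  then have "finite {x. h x \<noteq> x}" using assms(1) finite_subset by blast
  moreover have "h x = q x" if "x \<in> A" for x using that by (simp add: h_def)
  ultimately show thesis by (rule that)
qed

definition fixator :: "'a set \<Rightarrow> ('a \<Rightarrow> 'a) set" where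
  "fixator F = {g. bij g \<and> (\<forall>x\<in>F. g x = x)}"

lemma id_in_fixator: "id \<in> fixator F"
  by (simp add: fixator_def)

lemma fixator_eq_iff:
  assumes "a \<in> fixator F" and "y \<in> F"
  shows "a x = y \<longleftrightarrow> x = y"
proof -
  have "inj a" "a y = y" using assms by (auto simp: fixator_def bij_is_inj)
  then show ?thesis using inj_eq[of a x y] by simp
qed

lemma fixator_left_factor:
  assumes "bij k" "bij k'" and eq: "\<And>x. k x \<in> F \<Longrightarrow> k' x = k x"
  obtains a where "a \<in> fixator F" "k = a \<circ> k'"
proof
  show "k = (k \<circ> inv k') \<circ> k'"
    using assms(2) by (simp add: comp_assoc bij_is_inj)
  have "(k \<circ> inv k') y = y" if "y \<in> F" for y
  proof -
    obtain x where x: "k x = y" using assms(1) by (metis bij_pointE)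
    then have "inv k' y = x" using eq[of x] that assms(2) by (simp add: inv_f_eq bij_is_inj)
    with x show ?thesis by simp
  qed
  then show "k \<circ> inv k' \<in> fixator F"
    using assms(1,2) by (simp add: fixator_def bij_comp bij_imp_bij_inv)
qed

lemma topspace_perm_top [simp]: "topspace perm_top = {g. bij g}"
  by (auto simp: perm_top_def)

lemma continuous_map_perm_eval: "continuous_map perm_top (discrete_topology UNIV) (\<lambda>g. g x)"
  unfolding perm_top_def
  by (intro continuous_map_from_subtopology continuous_map_product_projection) simp

lemma clopen_perm_value:
  "openin perm_top {g. bij g \<and> g x = y}" "closedin perm_top {g. bij g \<and> g x = y}"
  using openin_continuous_map_preimage[OF continuous_map_perm_eval, of "{y}" x]
    closedin_continuous_map_preimage[OF continuous_map_perm_eval, of "{y}" x] by simp_all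

lemma openin_perm_top_fixator:
  assumes "finite F"
  shows "openin perm_top (fixator F)"
proof -
  have "fixator F = (\<Inter>x\<in>F. {g. bij g \<and> g x = x}) \<inter> topspace perm_top"
    by (auto simp: fixator_def)
  then show ?thesis
    using assms by (simp only: openin_INT clopen_perm_value)
qed

lemma fixator_subset_nbhd_id:
  assumes "openin perm_top U" "id \<in> U"
  obtains F where "finite F" "fixator F \<subseteq> U"
proof -
  obtain T where T: "openin (product_topology (\<lambda>_. discrete_topology UNIV) UNIV) T"
    "U = T \<inter> {f. bij f}"
    using assms(1) by (auto simp: perm_top_def openin_subtopology)
  then obtain V where V: "finite {x. V x \<noteq> UNIV}" "id \<in> Pi\<^sub>E UNIV V" "Pi\<^sub>E UNIV V \<subseteq> T"
    using assms(2) by (auto simp: openin_product_topology_alt)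
  have "g \<in> Pi\<^sub>E UNIV V" if "g \<in> fixator {x. V x \<noteq> UNIV}" for g
    using that V(2) by (auto simp: fixator_def PiE_iff) (metis UNIV_I)
  then have "fixator {x. V x \<noteq> UNIV} \<subseteq> U"
    using T(2) V(3) by (fastforce simp: fixator_def)
  with V(1) show thesis by (rule that)
qed

lemma continuous_map_perm_action:
  "continuous_map (prod_topology perm_top alphaX) alphaX (\<lambda>(g, w). map_option g w)"
  unfolding continuous_map_into_alphaX_iff
proof (intro allI conjI)
  fix y :: 'a
  let ?P = "prod_topology perm_top alphaX :: (('a \<Rightarrow> 'a) \<times> 'a option) topology"
  let ?A = "{p \<in> topspace ?P. (case p of (g, w) \<Rightarrow> map_option g w) = Some y}"
  have "?A = (\<Union>x. {g. bij g \<and> g x = y} \<times> {Some x})" by auto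
  moreover have "openin ?P \<dots>"
    by (intro openin_Union) (auto simp: openin_prod_Times_iff clopen_perm_value clopen_alphaX_Some)
  ultimately show "openin ?P ?A" by (simp only:)
  have "topspace ?P - ?A = (\<Union>x. {g. bij g \<and> g x = y} \<times> (topspace alphaX - {Some x}))"
    by (auto dest: bij_is_inj injD) (metis bij_pointE)
  moreover have "openin ?P \<dots>"
    by (intro openin_Union)
      (auto simp: openin_prod_Times_iff clopen_perm_value simp del: topspace_alphaX
        intro!: openin_diff clopen_alphaX_Some)
  ultimately show "closedin ?P ?A" by (simp only: closedin_def) auto
qed


section \<open>Partial injections\<close>

definition pinj_top :: "('a option \<Rightarrow> 'a option) topology" where
  "pinj_top = subtopology (product_topology (\<lambda>_. alphaX) UNIV) pinj_maps"

lemma pinj_maps_iff: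
  "f \<in> pinj_maps \<longleftrightarrow> f None = None \<and> (\<forall>x x' y. f (Some x) = Some y \<and> f (Some x') = Some y \<longrightarrow> x = x')"
  (is "_ \<longleftrightarrow> ?injective")
proof
  assume "f \<in> pinj_maps"
  then obtain Y where inj: "inj_on f (Some ` Y)" and Y: "f ` (UNIV - Some ` Y) = {None}"
    by (auto simp: pinj_maps_def)
  have none: "f w = None" if "w \<notin> Some ` Y" for w using Y that by blast
  have "Some x \<in> Some ` Y" if "f (Some x) = Some y" for x y
    using none[of "Some x"] that by force
  then have "x = x'" if "f (Some x) = Some y" "f (Some x') = Some y" for x x' y
    using inj_onD[OF inj, of "Some x" "Some x'"] that by auto
  then show ?injective using none[of None] by blast
next
  assume inj: ?injective
  let ?Y = "{x. f (Some x) \<noteq> None}"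
  have outside: "f w = None" if "w \<in> UNIV - Some ` ?Y" for w
    using that inj by (cases w) auto
  have "f ` (UNIV - Some ` ?Y) = {None}"
  proof
    show "f ` (UNIV - Some ` ?Y) \<subseteq> {None}"
      by (rule image_subsetI) (simp only: outside singleton_iff)
    show "{None} \<subseteq> f ` (UNIV - Some ` ?Y)"
      using inj by (auto intro: rev_image_eqI[of None])
  qed
  moreover have "inj_on f (Some ` ?Y)" using inj by (auto simp: inj_on_def)
  ultimately show "f \<in> pinj_maps"
    unfolding pinj_maps_def by (intro CollectI exI[of _ ?Y]) auto
qed

lemma option_fun_eqI:
  assumes "f None = g None" and some: "\<And>x y. f (Some x) = Some y \<longleftrightarrow> g (Some x) = Some y"
  shows "f = g"
proof
  fix w
  have "f (Some x) = g (Some x)" for x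
    by (metis some not_Some_eq)
  with assms(1) show "f w = g w" by (cases w) simp_all
qed

lemma pinj_None: "f \<in> pinj_maps \<Longrightarrow> f None = None"
  and pinj_inj: "f \<in> pinj_maps \<Longrightarrow> f (Some x) = Some y \<Longrightarrow> f (Some x') = Some y \<Longrightarrow> x = x'"
  by (auto simp: pinj_maps_iff)

lemma finite_pinj_vimage:
  assumes "f \<in> pinj_maps" and "finite F"
  shows "finite {x. f (Some x) \<in> Some ` F}"
proof (rule finite_imageD)
  show "finite ((\<lambda>x. f (Some x)) ` {x. f (Some x) \<in> Some ` F})"
    using assms(2) by (rule finite_subset[rotated, OF finite_imageI]) auto
  show "inj_on (\<lambda>x. f (Some x)) {x. f (Some x) \<in> Some ` F}"
    using pinj_inj[OF assms(1)] by (fastforce simp: inj_on_def)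
qed

lemma map_option_pinj: "bij g \<Longrightarrow> map_option g \<in> pinj_maps"
  by (auto simp: pinj_maps_iff bij_def inj_def)

lemma pinj_comp:
  assumes "f \<in> pinj_maps" "g \<in> pinj_maps"
  shows "f \<circ> g \<in> pinj_maps"
proof -
  have "x = x'" if eq: "f (g (Some x)) = Some y" "f (g (Some x')) = Some y" for x x' y
  proof -
    obtain u u' where u: "g (Some x) = Some u" "g (Some x') = Some u'"
      using eq pinj_None[OF assms(1)] by (cases "g (Some x)"; cases "g (Some x')") auto
    then have "u = u'" using eq pinj_inj[OF assms(1)] by simp
    then show ?thesis using u pinj_inj[OF assms(2)] by simp
  qed
  then show ?thesis
    using pinj_None[OF assms(1)] pinj_None[OF assms(2)] by (auto simp: pinj_maps_iff[of "f \<circ> g"])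
qed

lemma topspace_pinj_top [simp]: "topspace pinj_top = pinj_maps"
  by (simp add: pinj_top_def)

lemma Hausdorff_space_pinj_top: "Hausdorff_space pinj_top"
  by (simp add: pinj_top_def Hausdorff_space_subtopology Hausdorff_space_product_topology
      Hausdorff_space_alphaX)

lemma continuous_map_into_pinj_top_iff:
  "continuous_map S pinj_top h \<longleftrightarrow>
    (\<forall>w. continuous_map S alphaX (\<lambda>s. h s w)) \<and> (\<forall>s\<in>topspace S. h s \<in> pinj_maps)"
  by (auto simp: pinj_top_def continuous_map_in_subtopology continuous_map_componentwise_UNIV)

lemma continuous_map_pinj_eval: "continuous_map pinj_top alphaX (\<lambda>f. f w)"
  unfolding pinj_top_def
  by (intro continuous_map_from_subtopology continuous_map_product_projection) simp

lemma clopen_pinj_value: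
  "openin pinj_top {f \<in> pinj_maps. f w = Some y}" "closedin pinj_top {f \<in> pinj_maps. f w = Some y}"
  using continuous_map_pinj_eval[of w] by (simp_all add: continuous_map_into_alphaX_iff)

lemma openin_pinj_value_iff:
  "openin pinj_top {f \<in> pinj_maps. f w = Some y \<longleftrightarrow> P}"
proof (cases P)
  case False
  then have "{f \<in> pinj_maps. f w = Some y \<longleftrightarrow> P} =
      topspace pinj_top - {f \<in> pinj_maps. f w = Some y}" by auto
  then show ?thesis by (simp only: openin_diff openin_topspace clopen_pinj_value)
qed (simp add: clopen_pinj_value)

lemma closedin_pinj_maps: "closedin (product_topology (\<lambda>_. alphaX) UNIV) pinj_maps"
proof -
  let ?P = "product_topology (\<lambda>_. alphaX) UNIV :: ('a option \<Rightarrow> 'a option) topology"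
  have eval: "continuous_map ?P alphaX (\<lambda>f. f w)" for w
    by (rule continuous_map_product_projection) simp
  have value_open: "openin ?P {f. f w = Some y}" for w y
    using eval[of w] by (simp add: continuous_map_into_alphaX_iff)
  have "openin ?P {f. f None \<noteq> None}"
    using openin_continuous_map_preimage[OF eval[of None], of "- {None}"] by (simp add: openin_alphaX)
  moreover have "openin ?P
      (\<Union>(x, x', y)\<in>{(x, x', y). x \<noteq> x'}. {f. f (Some x) = Some y} \<inter> {f. f (Some x') = Some y})"
    by (intro openin_Union) (auto intro!: value_open openin_Int)
  moreover have "topspace ?P - pinj_maps = {f. f None \<noteq> None} \<union>
      (\<Union>(x, x', y)\<in>{(x, x', y). x \<noteq> x'}. {f. f (Some x) = Some y} \<inter> {f. f (Some x') = Some y})"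
    by (auto simp: pinj_maps_iff) blast
  ultimately show ?thesis by (simp only: closedin_def openin_Un) simp
qed

lemma compact_space_pinj_top: "compact_space pinj_top"
  unfolding pinj_top_def
  by (intro compact_space_subtopology closedin_compact_space closedin_pinj_maps)
    (simp add: compact_space_product_topology compact_space_alphaX)

definition graph_in :: "'a set \<Rightarrow> ('a option \<Rightarrow> 'a option) \<Rightarrow> ('a \<times> 'a) set" where
  "graph_in F f = {(x, y) \<in> F \<times> F. f (Some x) = Some y}"

lemma graph_in_eq_iff:
  "graph_in F f = graph_in F g \<longleftrightarrow> (\<forall>x\<in>F. \<forall>y\<in>F. f (Some x) = Some y \<longleftrightarrow> g (Some x) = Some y)"
  by (auto simp: graph_in_def)

lemma openin_graph_in:
  assumes "finite F"
  shows "openin pinj_top {f \<in> pinj_maps. graph_in F f = graph_in F z}"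
proof -
  have "{f \<in> pinj_maps. graph_in F f = graph_in F z} =
      (\<Inter>(x, y)\<in>F \<times> F. {f \<in> pinj_maps. f (Some x) = Some y \<longleftrightarrow> z (Some x) = Some y}) \<inter> topspace pinj_top"
    by (auto simp: graph_in_eq_iff)
  then show ?thesis
    using assms by (simp only: split_beta openin_INT finite_SigmaI openin_pinj_value_iff)
qed

lemma openin_graph_in_entourage:
  assumes "finite F"
  shows "openin (prod_topology pinj_top pinj_top)
    {(f, g). f \<in> pinj_maps \<and> g \<in> pinj_maps \<and> graph_in F f = graph_in F g}"
proof -
  let ?N = "\<lambda>z. {f \<in> pinj_maps. graph_in F f = graph_in F z}"
  have "{(f, g). f \<in> pinj_maps \<and> g \<in> pinj_maps \<and> graph_in F f = graph_in F g} =
      (\<Union>z\<in>pinj_maps. ?N z \<times> ?N z)"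
    by auto
  moreover have "openin (prod_topology pinj_top pinj_top) \<dots>"
    by (intro openin_Union) (auto simp: openin_prod_Times_iff openin_graph_in[OF assms])
  ultimately show ?thesis by (simp only:)
qed

lemma openin_pinj_values_differ:
  "openin (prod_topology pinj_top pinj_top)
    {(f, g). f \<in> pinj_maps \<and> g \<in> pinj_maps \<and> (f w = Some y) \<noteq> (g w = Some y)}"
proof -
  let ?A = "\<lambda>b. {f \<in> pinj_maps. f w = Some y \<longleftrightarrow> b}"
  have "{(f, g). f \<in> pinj_maps \<and> g \<in> pinj_maps \<and> (f w = Some y) \<noteq> (g w = Some y)} =
      ?A True \<times> ?A False \<union> ?A False \<times> ?A True" by auto
  moreover have "openin (prod_topology pinj_top pinj_top) \<dots>"
    by (intro openin_Un openin_prod_Times_iff[THEN iffD2] disjI2 conjI openin_pinj_value_iff)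
  ultimately show ?thesis by (simp only:)
qed

lemma graph_in_subset_entourage:
  fixes W :: "(('a option \<Rightarrow> 'a option) \<times> ('a option \<Rightarrow> 'a option)) set"
  assumes W: "openin (prod_topology pinj_top pinj_top) W" and diag: "\<And>z. z \<in> pinj_maps \<Longrightarrow> (z, z) \<in> W"
  obtains F where "finite F"
    "\<And>f g. f \<in> pinj_maps \<Longrightarrow> g \<in> pinj_maps \<Longrightarrow> graph_in F f = graph_in F g \<Longrightarrow> (f, g) \<in> W"
proof -
  let ?K = "topspace (prod_topology pinj_top pinj_top) - W"
  define differ :: "'a \<times> 'a \<Rightarrow> (('a option \<Rightarrow> 'a option) \<times> ('a option \<Rightarrow> 'a option)) set"
    where "differ = (\<lambda>(x, y). {(f, g). f \<in> pinj_maps \<and> g \<in> pinj_maps \<and>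
      (f (Some x) = Some y) \<noteq> (g (Some x) = Some y)})"
  have compact: "compactin (prod_topology pinj_top pinj_top) ?K"
    by (intro closedin_compact_space closedin_diff closedin_topspace W)
      (simp add: compact_space_prod_topology compact_space_pinj_top)
  have cover: "?K \<subseteq> \<Union>(range differ)"
  proof clarify
    fix f g assume fg: "(f, g) \<in> topspace (prod_topology pinj_top pinj_top)" "(f, g) \<notin> W"
    then have "f \<noteq> g" "f None = g None" using diag by (auto simp: pinj_None)
    then obtain x y where "(f (Some x) = Some y) \<noteq> (g (Some x) = Some y)"
      using option_fun_eqI[of f g] by blast
    then have "(f, g) \<in> differ (x, y)" using fg(1) by (auto simp: differ_def)
    then show "(f, g) \<in> \<Union>(range differ)" by blast
  qed
  have "openin (prod_topology pinj_top pinj_top) (differ p)" for p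
    by (cases p) (simp only: differ_def split openin_pinj_values_differ)
  then obtain \<F> where \<F>: "finite \<F>" "\<F> \<subseteq> range differ" "?K \<subseteq> \<Union>\<F>"
    using compactinD[OF compact _ cover] by blast
  then obtain T where T: "finite T" "\<F> = differ ` T"
    using finite_subset_image[OF \<F>(1,2)] by blast
  show thesis
  proof (rule that[of "fst ` T \<union> snd ` T"])
    show "finite (fst ` T \<union> snd ` T)" using T(1) by simp
    fix f g
    assume fg: "f \<in> pinj_maps" "g \<in> pinj_maps"
      "graph_in (fst ` T \<union> snd ` T) f = graph_in (fst ` T \<union> snd ` T) g"
    have "(f, g) \<notin> differ p" if "p \<in> T" for p
    proof -
      have "fst p \<in> fst ` T \<union> snd ` T" "snd p \<in> fst ` T \<union> snd ` T" using that by auto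
      then have "f (Some (fst p)) = Some (snd p) \<longleftrightarrow> g (Some (fst p)) = Some (snd p)"
        using fg(3) unfolding graph_in_eq_iff by blast
      then show ?thesis by (auto simp: differ_def split_beta)
    qed
    then show "(f, g) \<in> W" using \<F>(3) T(2) fg(1,2) by auto
  qed
qed

lemma graph_in_subset_nbhd:
  assumes U: "openin pinj_top U" "z \<in> U"
  obtains F where "finite F" "{f \<in> pinj_maps. graph_in F f = graph_in F z} \<subseteq> U"
proof -
  let ?W = "U \<times> U \<union> (topspace pinj_top - {z}) \<times> topspace pinj_top"
  have sub: "U \<subseteq> pinj_maps" using openin_subset[OF U(1)] by simp
  then have "closedin pinj_top {z}"
    using U(2) by (intro closedin_Hausdorff_singleton Hausdorff_space_pinj_top) auto
  then have "openin (prod_topology pinj_top pinj_top) ?W"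
    by (intro openin_Un openin_prod_Times_iff[THEN iffD2] disjI2 conjI openin_diff openin_topspace U(1))
  moreover have "(f, f) \<in> ?W" if "f \<in> pinj_maps" for f using that U(2) by auto
  ultimately obtain F where "finite F"
    and W: "\<And>f g. f \<in> pinj_maps \<Longrightarrow> g \<in> pinj_maps \<Longrightarrow> graph_in F f = graph_in F g \<Longrightarrow> (f, g) \<in> ?W"
    using graph_in_subset_entourage[of ?W] by blast
  have "f \<in> U" if "f \<in> pinj_maps" "graph_in F f = graph_in F z" for f
    using W[of z f] that sub U(2) by auto
  with \<open>finite F\<close> show thesis by (intro that[of F]) auto
qed


section \<open>Permutations as partial injections\<close>

lemma permutation_with_graph_in:
  assumes "infinite (UNIV :: 'a set)" and F: "finite (F :: 'a set)" and z: "z \<in> pinj_maps"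
  obtains g where "bij g" "graph_in F (map_option g) = graph_in F z"
proof -
  obtain R where "finite R" "card R = card F" "R \<subseteq> - F"
    using infinite_arbitrarily_large[of "- F" "card F"] assms(1) F by (auto simp: Compl_eq_Diff_UNIV)
  then obtain r where r: "inj_on r F" "r ` F \<subseteq> - F"
    using finite_same_card_bij[OF F] by (metis bij_betw_def)
  define D where "D = {x \<in> F. z (Some x) \<in> Some ` F}"
  define q where "q x = (if x \<in> D then the (z (Some x)) else r x)" for x
  have "inj_on (\<lambda>x. the (z (Some x))) D"
    using pinj_inj[OF z] by (fastforce simp: inj_on_def D_def)
  then have "inj_on q (D \<union> (F - D))"
    unfolding q_def using r by (intro inj_on_disjoint_Un) (auto simp: D_def intro: inj_on_subset)
  then have "inj_on q F" by (rule inj_on_subset) blast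
  then obtain g where g: "bij g" "finite {x. g x \<noteq> x}" "\<And>x. x \<in> F \<Longrightarrow> g x = q x"
    by (rule finite_inj_on_extends_to_permutation[OF F]) (rule that)
  have "g x = y \<longleftrightarrow> z (Some x) = Some y" if "x \<in> F" "y \<in> F" for x y
  proof (cases "x \<in> D")
    case True
    then obtain v where "z (Some x) = Some v" by (auto simp: D_def)
    with True show ?thesis using g(3)[OF that(1)] by (simp add: q_def)
  next
    case False
    then have "g x \<notin> F" using g(3)[OF that(1)] r(2) that(1) by (auto simp: q_def)
    moreover have "z (Some x) \<noteq> Some y" using False that by (auto simp: D_def)
    ultimately show ?thesis using that(2) by blast
  qed
  then have "graph_in F (map_option g) = graph_in F z" by (simp add: graph_in_eq_iff)
  with g(1) show thesis by (rule that)
qed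

lemma closure_of_permutations:
  assumes "infinite (UNIV :: 'a set)"
  shows "pinj_top closure_of (map_option ` {g :: 'a \<Rightarrow> 'a. bij g}) = pinj_maps"
proof
  show "pinj_top closure_of (map_option ` {g :: 'a \<Rightarrow> 'a. bij g}) \<subseteq> pinj_maps"
    using closure_of_subset_topspace[of pinj_top] by simp
  show "pinj_maps \<subseteq> pinj_top closure_of (map_option ` {g :: 'a \<Rightarrow> 'a. bij g})"
  proof
    fix z :: "'a option \<Rightarrow> 'a option" assume z: "z \<in> pinj_maps"
    have "\<exists>f\<in>map_option ` {g. bij g}. f \<in> U" if U: "openin pinj_top U" "z \<in> U" for U
    proof -
      obtain F where F: "finite F" "{f \<in> pinj_maps. graph_in F f = graph_in F z} \<subseteq> U"
        using graph_in_subset_nbhd[OF U] .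
      obtain g where "bij g" "graph_in F (map_option g) = graph_in F z"
        using permutation_with_graph_in[OF assms F(1) z] .
      with F(2) show ?thesis using map_option_pinj by blast
    qed
    with z show "z \<in> pinj_top closure_of (map_option ` {g. bij g})"
      by (auto simp: in_closure_of)
  qed
qed

lemma env_map_alphaX: "env_map alphaX (\<lambda>g. map_option g) = map_option"
  by (simp add: env_map_def fun_eq_iff)

lemma env_top_alphaX:
  assumes "infinite (UNIV :: 'a set)"
  shows "env_top alphaX (\<lambda>g. map_option g) (topspace perm_top) =
    (pinj_top :: ('a option \<Rightarrow> 'a option) topology)"
proof -
  let ?P = "product_topology (\<lambda>_. alphaX) UNIV :: ('a option \<Rightarrow> 'a option) topology"
  let ?S = "map_option ` {g :: 'a \<Rightarrow> 'a. bij g}"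
  have "?P closure_of ?S = pinj_maps"
  proof
    show "?P closure_of ?S \<subseteq> pinj_maps"
      using map_option_pinj by (intro closure_of_minimal closedin_pinj_maps) blast
    show "pinj_maps \<subseteq> ?P closure_of ?S"
      using closure_of_subtopology_subset[of ?P pinj_maps ?S] closure_of_permutations[OF assms]
      by (simp add: pinj_top_def)
  qed
  then show ?thesis by (simp add: env_top_def pinj_top_def restrict_def)
qed

lemma continuous_map_map_option: "continuous_map perm_top pinj_top map_option"
proof -
  have "continuous_map perm_top alphaX ((\<lambda>(g, w). map_option g w) \<circ> (\<lambda>g. (g, w)))" for w :: "'a option"
    by (rule continuous_map_compose[OF _ continuous_map_perm_action])
      (simp add: continuous_map_pairwise comp_def)
  then show ?thesis
    by (simp add: continuous_map_into_pinj_top_iff map_option_pinj comp_def)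
qed

lemma homeomorphic_maps_perm_top:
  "homeomorphic_maps perm_top (subtopology pinj_top (map_option ` {g. bij g}))
     map_option (\<lambda>f x. the (f (Some x)))"
  unfolding homeomorphic_maps_def
proof (intro conjI)
  let ?S = "subtopology pinj_top (map_option ` {g :: 'a \<Rightarrow> 'a. bij g})"
  have top: "topspace ?S = map_option ` {g. bij g}" using map_option_pinj by auto
  show "continuous_map perm_top ?S map_option"
    by (simp add: continuous_map_in_subtopology continuous_map_map_option)
  have "continuous_map ?S (discrete_topology UNIV) (\<lambda>f. the (f (Some x)))" for x
    unfolding continuous_map_def
  proof (intro conjI allI impI)
    fix U :: "'a set"
    have "{f \<in> topspace ?S. the (f (Some x)) \<in> U} = (\<Union>y\<in>U. {f \<in> topspace ?S. f (Some x) = Some y})"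
      unfolding top by auto
    moreover have "openin ?S \<dots>"
      using continuous_map_from_subtopology[OF continuous_map_pinj_eval[of "Some x"]]
      by (intro openin_Union) (auto simp only: continuous_map_into_alphaX_iff)
    ultimately show "openin ?S {f \<in> topspace ?S. the (f (Some x)) \<in> U}" by (simp only:)
  qed simp
  then show "continuous_map ?S perm_top (\<lambda>f x. the (f (Some x)))"
    unfolding perm_top_def continuous_map_in_subtopology continuous_map_componentwise_UNIV top by auto
qed (use map_option_pinj in auto)

lemma embedding_map_map_option: "embedding_map perm_top pinj_top map_option"
  using homeomorphic_maps_imp_map[OF homeomorphic_maps_perm_top] by (simp add: embedding_map_def)

lemma compactification_pinj_top:
  assumes "infinite (UNIV :: 'a set)"
  shows "compactification (perm_top :: ('a \<Rightarrow> 'a) topology) pinj_top map_option"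
  using closure_of_permutations[OF assms]
  by (simp add: compactification_def compact_space_pinj_top Hausdorff_space_pinj_top
      embedding_map_map_option)


section \<open>The Roelcke compactification\<close>

lemma graph_in_eq_imp_translate:
  assumes F: "finite F" and g: "bij g" "bij g'"
    and graph: "graph_in F (map_option g) = graph_in F (map_option g')"
  obtains t where "t \<in> fixator F" "finite {x. t x \<noteq> x}" "\<And>x. g' x \<in> F \<Longrightarrow> g (t x) = g' x"
proof -
  have same_values: "g x = y \<longleftrightarrow> g' x = y" if "x \<in> F" "y \<in> F" for x y
    using graph that by (simp add: graph_in_eq_iff)
  have inv: "inv g y = x \<longleftrightarrow> y = g x" for x y
    using bij_inv_eq_iff[OF g(1), of x y] by auto
  let ?A = "g' -` F"
  define q where "q x = (if x \<in> g' -` F then inv g (g' x) else x)" for x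
  have "inj_on (\<lambda>x. inv g (g' x)) ?A"
    using bij_comp[OF g(2) bij_imp_bij_inv[OF g(1)]]
    by (auto simp: comp_def intro: inj_on_subset bij_is_inj)
  moreover have "inv g (g' x) \<notin> F - ?A" if "x \<in> ?A" for x
  proof
    assume outside: "inv g (g' x) \<in> F - ?A"
    have "g (inv g (g' x)) = g' x" using g(1) by (simp add: bij_is_surj surj_f_inv_f)
    with outside that same_values show False by auto
  qed
  then have "(\<lambda>x. inv g (g' x)) ` ?A \<inter> (\<lambda>x. x) ` (F - ?A) = {}" by auto
  ultimately have "inj_on q (?A \<union> (F - ?A))"
    unfolding q_def by (intro inj_on_disjoint_Un) simp_all
  then obtain t where t: "bij t" "finite {x. t x \<noteq> x}" "\<And>x. x \<in> ?A \<union> (F - ?A) \<Longrightarrow> t x = q x"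
    using finite_inj_on_extends_to_permutation[of "?A \<union> (F - ?A)" q] F g(2)
    by (auto simp: finite_vimageI bij_is_inj)
  show thesis
  proof (rule that[OF _ t(2)])
    have "t x = x" if "x \<in> F" for x
      using t(3)[of x] that same_values[of x "g' x"] by (auto simp: q_def inv)
    with t(1) show "t \<in> fixator F" by (simp add: fixator_def)
    show "g (t x) = g' x" if "g' x \<in> F" for x
      using t(3)[of x] that g(1) by (simp add: q_def bij_is_surj surj_f_inv_f)
  qed
qed

lemma dbl_fixator_eq:
  assumes "finite F" and "bij g"
  shows "dbl (\<circ>) (fixator F) g = {b. bij b \<and> graph_in F (map_option b) = graph_in F (map_option g)}"
proof (intro subset_antisym subsetI)
  fix b assume "b \<in> dbl (\<circ>) (fixator F) g"
  then obtain a c where b: "b = a \<circ> g \<circ> c" and ac: "a \<in> fixator F" "c \<in> fixator F"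
    by (auto simp: dbl_def)
  then have "graph_in F (map_option b) = graph_in F (map_option g)"
    using fixator_eq_iff[OF ac(1)] by (simp add: graph_in_eq_iff fixator_def)
  moreover have "bij b"
    using ac \<open>bij g\<close> by (simp add: b fixator_def bij_comp)
  ultimately show "b \<in> {b. bij b \<and> graph_in F (map_option b) = graph_in F (map_option g)}" by simp
next
  fix b assume "b \<in> {b. bij b \<and> graph_in F (map_option b) = graph_in F (map_option g)}"
  then have b: "bij b" "graph_in F (map_option g) = graph_in F (map_option b)" by auto
  obtain t where t: "t \<in> fixator F" "finite {x. t x \<noteq> x}" "\<And>x. b x \<in> F \<Longrightarrow> g (t x) = b x"
    by (rule graph_in_eq_imp_translate[OF assms b]) (rule that)
  obtain a where "a \<in> fixator F" "b = a \<circ> (g \<circ> t)"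
    using fixator_left_factor[of b "g \<circ> t" F] b(1) t(1,3) \<open>bij g\<close>
    by (auto simp: fixator_def intro: bij_comp)
  with t(1) show "b \<in> dbl (\<circ>) (fixator F) g" by (auto simp: dbl_def comp_assoc)
qed

lemma dbl_mono: "U \<subseteq> V \<Longrightarrow> dbl m U g \<subseteq> dbl m V g"
  by (auto simp: dbl_def)

lemma roelcke_compactification_pinj_top:
  assumes "infinite (UNIV :: 'a set)"
  shows "roelcke_compactification (perm_top :: ('a \<Rightarrow> 'a) topology) (\<circ>) id pinj_top map_option"
  unfolding roelcke_compactification_def
proof (intro conjI allI impI)
  show "compactification (perm_top :: ('a \<Rightarrow> 'a) topology) pinj_top map_option"
    by (rule compactification_pinj_top[OF assms])
next
  fix W :: "(('a option \<Rightarrow> 'a option) \<times> ('a option \<Rightarrow> 'a option)) set"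
  assume "openin (prod_topology pinj_top pinj_top) W \<and> (\<forall>z\<in>topspace pinj_top. (z, z) \<in> W)"
  then obtain F where F: "finite F"
    and W: "\<And>f g. f \<in> pinj_maps \<Longrightarrow> g \<in> pinj_maps \<Longrightarrow> graph_in F f = graph_in F g \<Longrightarrow> (f, g) \<in> W"
    using graph_in_subset_entourage[of W] unfolding topspace_pinj_top by blast
  show "\<exists>U. openin perm_top U \<and> id \<in> U \<and>
      (\<forall>g\<in>topspace perm_top. \<forall>a\<in>dbl (\<circ>) U g. \<forall>b\<in>dbl (\<circ>) U g. (map_option a, map_option b) \<in> W)"
    using F by (intro exI[of _ "fixator F"])
      (auto simp: openin_perm_top_fixator dbl_fixator_eq id_in_fixator intro!: W map_option_pinj)
next
  fix U :: "('a \<Rightarrow> 'a) set" assume "openin perm_top U \<and> id \<in> U"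
  then obtain F where F: "finite F" "fixator F \<subseteq> U" using fixator_subset_nbhd_id by blast
  have "a \<in> dbl (\<circ>) U a" "b \<in> dbl (\<circ>) U a"
    if "bij a" "bij b" "graph_in F (map_option a) = graph_in F (map_option b)" for a b
    using dbl_mono[OF F(2)] dbl_fixator_eq[OF F(1) that(1)] that by auto
  then show "\<exists>W. openin (prod_topology pinj_top pinj_top) W \<and> (\<forall>z\<in>topspace pinj_top. (z, z) \<in> W) \<and>
      (\<forall>a\<in>topspace perm_top. \<forall>b\<in>topspace perm_top. (map_option a, map_option b) \<in> W \<longrightarrow>
        (\<exists>g\<in>topspace perm_top. a \<in> dbl (\<circ>) U g \<and> b \<in> dbl (\<circ>) U g))"
    by (intro exI[of _ "{(f, g). f \<in> pinj_maps \<and> g \<in> pinj_maps \<and> graph_in F f = graph_in F g}"])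
      (auto simp: openin_graph_in_entourage[OF F(1)])
qed

lemma roelcke_precompact_perm_top: "roelcke_precompact (perm_top :: ('a \<Rightarrow> 'a) topology) (\<circ>) id"
  unfolding roelcke_precompact_def
proof (intro allI impI)
  fix U :: "('a \<Rightarrow> 'a) set" assume U: "openin perm_top U \<and> id \<in> U"
  then obtain F where F: "finite F" "fixator F \<subseteq> U" using fixator_subset_nbhd_id by blast
  have U_bij: "bij u" if "u \<in> U" for u using openin_subset[of perm_top U] U that by auto
  let ?graph = "\<lambda>g. graph_in F (map_option g)"
  have "?graph ` {g. bij g} \<subseteq> Pow (F \<times> F)" by (auto simp: graph_in_def)
  then have "finite (?graph ` {g. bij g})"
    using F(1) by (meson finite_Pow_iff finite_SigmaI finite_subset)
  then obtain R where R: "R \<subseteq> {g. bij g}" "finite R" "?graph ` {g. bij g} = ?graph ` R"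
    using finite_subset_image[of "?graph ` {g. bij g}" ?graph "{g. bij g}"] by blast
  have "\<exists>r\<in>R. g \<in> dbl (\<circ>) U r" if "bij g" for g
  proof -
    have "?graph g \<in> ?graph ` R" using that R(3) by blast
    then obtain r where "r \<in> R" "?graph g = ?graph r" by blast
    then show ?thesis using dbl_fixator_eq[OF F(1), of r] dbl_mono[OF F(2)] R(1) that by blast
  qed
  moreover have "bij g" if "g \<in> dbl (\<circ>) U r" "r \<in> R" for g r
    using that R(1) U_bij by (auto simp: dbl_def intro!: bij_comp)
  ultimately have "topspace perm_top = \<Union> (dbl (\<circ>) U ` R)" by auto
  with R show "\<exists>F. finite F \<and> F \<subseteq> topspace perm_top \<and> topspace perm_top = \<Union> (dbl (\<circ>) U ` F)"
    by (intro exI[of _ R]) simp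
qed


section \<open>The semigroup structure\<close>

definition pinj_inverse :: "('a option \<Rightarrow> 'a option) \<Rightarrow> 'a option \<Rightarrow> 'a option" where
  "pinj_inverse f w =
    (if w \<noteq> None \<and> (\<exists>x. f (Some x) = w) then Some (THE x. f (Some x) = w) else None)"

lemma pinj_inverse_eq_Some_iff:
  assumes "f \<in> pinj_maps"
  shows "pinj_inverse f (Some y) = Some x \<longleftrightarrow> f (Some x) = Some y"
proof -
  have "(THE x'. f (Some x') = Some y) = x" if "f (Some x) = Some y" for x
    using that pinj_inj[OF assms] by blast
  then show ?thesis by (auto simp: pinj_inverse_def)
qed

lemma pinj_inverse_None: "pinj_inverse f None = None"
  by (simp add: pinj_inverse_def)

lemma pinj_inverse_pinj: "f \<in> pinj_maps \<Longrightarrow> pinj_inverse f \<in> pinj_maps"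
  by (auto simp: pinj_maps_iff[of "pinj_inverse f"] pinj_inverse_None pinj_inverse_eq_Some_iff)

lemma pinj_comp_comp_eq_iff:
  assumes a: "a \<in> pinj_maps" and b: "b \<in> pinj_maps"
  shows "a \<circ> b \<circ> a = a \<longleftrightarrow> (\<forall>x y. a (Some x) = Some y \<longrightarrow> b (Some y) = Some x)"
proof (intro iffI allI impI)
  fix x y assume "a \<circ> b \<circ> a = a" and y: "a (Some x) = Some y"
  then have "a (b (Some y)) = Some y" by (metis comp_apply)
  moreover from this obtain x' where "b (Some y) = Some x'"
    using pinj_None[OF a] by (cases "b (Some y)") auto
  ultimately show "b (Some y) = Some x" using pinj_inj[OF a, of x'] y by simp
next
  assume inverse: "\<forall>x y. a (Some x) = Some y \<longrightarrow> b (Some y) = Some x"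
  have "a (b (a (Some x))) = a (Some x)" for x
    using inverse pinj_None[OF a] pinj_None[OF b] by (cases "a (Some x)") auto
  then have "(a \<circ> b \<circ> a) w = a w" for w
    using pinj_None[OF a] pinj_None[OF b] by (cases w) simp_all
  then show "a \<circ> b \<circ> a = a" by (rule ext)
qed

lemma is_inverse_of_pinj_iff:
  assumes s: "s \<in> pinj_maps"
  shows "is_inverse_of (\<circ>) pinj_maps s t \<longleftrightarrow> t = pinj_inverse s"
proof
  assume "is_inverse_of (\<circ>) pinj_maps s t"
  then have t: "t \<in> pinj_maps" and "s \<circ> t \<circ> s = s" "t \<circ> s \<circ> t = t"
    by (simp_all add: is_inverse_of_def)
  then have "t (Some y) = Some x \<longleftrightarrow> s (Some x) = Some y" for x y
    using pinj_comp_comp_eq_iff[OF s t] pinj_comp_comp_eq_iff[OF t s] by blast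
  then show "t = pinj_inverse s"
    by (intro option_fun_eqI)
      (simp_all add: pinj_None[OF t] pinj_inverse_None pinj_inverse_eq_Some_iff[OF s])
next
  assume "t = pinj_inverse s"
  then show "is_inverse_of (\<circ>) pinj_maps s t"
    using s
    by (simp add: is_inverse_of_def pinj_inverse_pinj pinj_comp_comp_eq_iff pinj_inverse_eq_Some_iff)
qed

lemma continuous_map_pinj_inverse: "continuous_map pinj_top pinj_top pinj_inverse"
  unfolding continuous_map_into_pinj_top_iff
proof (intro conjI allI ballI)
  fix w :: "'a option"
  show "continuous_map pinj_top alphaX (\<lambda>f. pinj_inverse f w)"
  proof (cases w)
    case None
    then show ?thesis by (simp add: pinj_inverse_None)
  next
    case (Some y)
    have "{f \<in> topspace pinj_top. pinj_inverse f (Some y) = Some x} =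
        {f \<in> pinj_maps. f (Some x) = Some y}" for x
      by (auto simp: pinj_inverse_eq_Some_iff)
    then show ?thesis
      by (simp only: Some continuous_map_into_alphaX_iff clopen_pinj_value simp_thms)
  qed
qed (simp add: pinj_inverse_pinj)

lemma continuous_map_pinj_map:
  assumes a: "a \<in> pinj_maps"
  shows "continuous_map alphaX alphaX a"
  unfolding continuous_map_into_alphaX_iff
proof
  fix y
  show "openin alphaX {w \<in> topspace alphaX. a w = Some y} \<and>
    closedin alphaX {w \<in> topspace alphaX. a w = Some y}"
  proof (cases "\<exists>x. a (Some x) = Some y")
    case True
    then obtain x where x: "a (Some x) = Some y" by blast
    have "a (Some u) = Some y \<longleftrightarrow> u = x" for u using pinj_inj[OF a _ x, of u] x by blast
    then have "a w = Some y \<longleftrightarrow> w = Some x" for w using pinj_None[OF a] by (cases w) simp_all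
    then show ?thesis by (simp add: clopen_alphaX_Some)
  next
    case False
    then have "a w \<noteq> Some y" for w using pinj_None[OF a] by (cases w) auto
    then show ?thesis by simp
  qed
qed

lemma continuous_map_pinj_comp:
  assumes a: "a \<in> pinj_maps"
  shows "continuous_map pinj_top pinj_top ((\<circ>) a)" "continuous_map pinj_top pinj_top (\<lambda>f. f \<circ> a)"
  using continuous_map_compose[OF continuous_map_pinj_eval continuous_map_pinj_map[OF a]]
    pinj_comp[OF a] pinj_comp[OF _ a]
  by (simp_all add: continuous_map_into_pinj_top_iff continuous_map_pinj_eval comp_def)

lemma continuous_map_perm_comp:
  "continuous_map (prod_topology perm_top pinj_top) pinj_top (\<lambda>(g, f). map_option g \<circ> f)"
  unfolding continuous_map_into_pinj_top_iff
proof (intro conjI allI ballI)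
  fix w :: "'a option"
  let ?P = "prod_topology perm_top pinj_top :: (('a \<Rightarrow> 'a) \<times> ('a option \<Rightarrow> 'a option)) topology"
  have "continuous_map ?P (prod_topology perm_top alphaX) (\<lambda>p. (fst p, snd p w))"
    using continuous_map_compose[OF continuous_map_snd continuous_map_pinj_eval[of w]]
    by (simp add: continuous_map_pairwise comp_def continuous_map_fst)
  from continuous_map_compose[OF this continuous_map_perm_action]
  show "continuous_map ?P alphaX (\<lambda>p. (case p of (g, f) \<Rightarrow> map_option g \<circ> f) w)"
    by (simp add: comp_def case_prod_unfold)
next
  fix p :: "('a \<Rightarrow> 'a) \<times> ('a option \<Rightarrow> 'a option)"
  assume "p \<in> topspace (prod_topology perm_top pinj_top)"
  then show "(case p of (g, f) \<Rightarrow> map_option g \<circ> f) \<in> pinj_maps"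
    by (auto simp: pinj_comp map_option_pinj)
qed

lemma sm_compactification_pinj_top:
  assumes "infinite (UNIV :: 'a set)"
  shows "sm_compactification (perm_top :: ('a \<Rightarrow> 'a) topology) (\<circ>) pinj_top map_option (\<circ>)"
  unfolding sm_compactification_def
proof (intro conjI)
  show "\<exists>u\<in>topspace pinj_top. \<forall>f\<in>topspace pinj_top. u \<circ> f = f \<and> f \<circ> u = (f :: 'a option \<Rightarrow> 'a option)"
    using map_option_pinj[of id] by (intro bexI[of _ id]) (auto simp: option.map_id0)
qed (simp_all add: compactification_pinj_top[OF assms] pinj_comp comp_assoc continuous_map_pinj_comp
    continuous_map_perm_comp option.map_comp fun_eq_iff)

lemma sim_compactification_pinj_top:
  assumes "infinite (UNIV :: 'a set)"
  shows "sim_compactification (perm_top :: ('a \<Rightarrow> 'a) topology) (\<circ>) pinj_top map_option (\<circ>)"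
proof -
  have "continuous_map pinj_top pinj_top
      (\<lambda>s :: 'a option \<Rightarrow> 'a option. THE t. is_inverse_of (\<circ>) pinj_maps s t)"
    by (rule continuous_map_eq[OF continuous_map_pinj_inverse]) (simp add: is_inverse_of_pinj_iff)
  then show ?thesis
    by (simp add: sim_compactification_def sm_compactification_pinj_top[OF assms] is_inverse_of_pinj_iff)
qed

lemma monoid_iso_pinj_maps:
  "monoid_iso_to_IX (pinj_maps :: ('a option \<Rightarrow> 'a option) set) (\<circ>) UNIV (\<lambda>f. f \<circ> Some)"
  unfolding monoid_iso_to_IX_def
proof (intro conjI ballI)
  show "bij_betw (\<lambda>f. f \<circ> Some) (pinj_maps :: ('a option \<Rightarrow> 'a option) set) (sym_inverse_semigroup UNIV)"
  proof (rule bij_betw_byWitness[where f' = "\<lambda>k w. Option.bind w k"])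
    have "Option.bind w (f \<circ> Some) = f w" if "f \<in> pinj_maps" for f :: "'a option \<Rightarrow> 'a option" and w
      using pinj_None[OF that] by (cases w) simp_all
    then show "\<forall>f\<in>pinj_maps. (\<lambda>w. Option.bind w (f \<circ> Some)) = (f :: 'a option \<Rightarrow> 'a option)"
      by blast
    show "\<forall>k\<in>sym_inverse_semigroup UNIV. (\<lambda>w. Option.bind w k) \<circ> Some = (k :: 'a \<rightharpoonup> 'a)"
      by (simp add: fun_eq_iff)
    show "(\<lambda>f. f \<circ> Some) ` pinj_maps \<subseteq> sym_inverse_semigroup (UNIV :: 'a set)"
      using pinj_inj by (fastforce simp: sym_inverse_semigroup_def inj_on_def)
    show "(\<lambda>k w. Option.bind w k) ` sym_inverse_semigroup (UNIV :: 'a set) \<subseteq> pinj_maps"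
      by (auto simp: pinj_maps_iff sym_inverse_semigroup_def inj_on_def) (metis domI)
  qed
  show "(s \<circ> t) \<circ> Some = (s \<circ> Some) \<circ>\<^sub>m (t \<circ> Some)" if "s \<in> pinj_maps" for s t :: "'a option \<Rightarrow> 'a option"
    by (rule ext) (simp add: map_comp_def pinj_None[OF that] split: option.split)
qed


section \<open>Compactifications of the discrete space\<close>

lemma G_compactification_alphaX:
  assumes "infinite (UNIV :: 'a set)"
  shows "G_compactification (perm_top :: ('a \<Rightarrow> 'a) topology) (\<lambda>g x. g x) (discrete_topology UNIV)
        alphaX Some (\<lambda>g. map_option g)"
proof -
  have "alphaX closure_of range Some = (UNIV :: 'a option set)"
    using Alexandroff_compactification_dense[of "discrete_topology (UNIV :: 'a set)"] assms
    by (simp add: alexandroff_eq_Alexandroff_compactification compact_space_discrete_topology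
        UNIV_option_conv)
  moreover have "embedding_map (discrete_topology UNIV) (alphaX :: 'a option topology) Some"
    unfolding alexandroff_eq_Alexandroff_compactification by (rule embedding_map_Some)
  ultimately show ?thesis
    by (simp add: G_compactification_def compactification_def compact_space_alphaX
        Hausdorff_space_alphaX continuous_map_perm_action)
qed

lemma perm_nbhd_id_transitive_off_finite:
  assumes "openin perm_top U" "id \<in> U"
  shows "\<exists>F. finite F \<and> (\<forall>x\<in>- F. \<forall>y\<in>- F. \<exists>g\<in>U. g x = y)"
proof -
  obtain F where F: "finite F" "fixator F \<subseteq> U" using fixator_subset_nbhd_id[OF assms] .
  have "Transposition.transpose x y \<in> fixator F" if "x \<notin> F" "y \<notin> F" for x y
    using that by (auto simp: fixator_def Transposition.transpose_def)
  then show ?thesis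
    using F by (intro exI[of _ F]) (metis ComplD subsetD transpose_apply_first)
qed

lemma G_compactification_discrete_unique:
  assumes inf: "infinite (UNIV :: 'a set)"
    and G: "G_compactification (perm_top :: ('a \<Rightarrow> 'a) topology) (\<lambda>g x. g x)
      (discrete_topology UNIV) K e \<alpha>"
  shows "equiv_compactification (discrete_topology UNIV) alphaX Some K e"
proof -
  have c: "compactification (discrete_topology UNIV) K e"
    using G by (simp add: G_compactification_def)
  have "p = q" if "p \<in> topspace K - range e" "q \<in> topspace K - range e" for p q
    by (rule G_compactification_remainder_unique[OF G, of id])
      (use that perm_nbhd_id_transitive_off_finite in \<open>auto simp flip: Compl_eq_Diff_UNIV\<close>)
  moreover have "topspace K - range e \<noteq> {}"
    using compactification_remainder_nonempty[OF c] inf by (simp add: compact_space_discrete_topology)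
  ultimately obtain r where "topspace K - range e = {r}" by blast
  then show ?thesis by (intro equiv_compactification_alexandroff[OF c]) simp
qed


section \<open>Maximality\<close>

lemma sm_compactification_imp_G_compactification:
  assumes "sm_compactification Gtop gmul K e m"
  shows "G_compactification Gtop gmul Gtop K e (\<lambda>g. m (e g))"
  using assms by (simp add: sm_compactification_def G_compactification_def)

lemma sm_compactification_double_limit:
  fixes u :: "'k \<Rightarrow> real" and g h :: "nat \<Rightarrow> 'g"
  assumes sm: "sm_compactification Gtop gmul K e m" and u: "continuous_map K euclideanreal u"
    and g: "\<And>i. g i \<in> topspace Gtop" and h: "\<And>j. h j \<in> topspace Gtop"
    and le: "\<And>i j. j \<le> i \<Longrightarrow> \<bar>u (e (gmul (g i) (h j))) - u (e (g i))\<bar> \<le> a"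
    and ge: "\<And>i j. i < j \<Longrightarrow> b \<le> \<bar>u (e (gmul (g i) (h j))) - u (e (g i))\<bar>"
  shows "b \<le> a"
proof (rule separately_continuous_double_limit[where \<phi> = "\<lambda>x y. \<bar>u (m x y) - u x\<bar>"
      and x = "\<lambda>i. e (g i)" and y = "\<lambda>j. e (h j)"])
  have c: "compactification Gtop K e"
    and sep: "\<And>c. c \<in> topspace K \<Longrightarrow> continuous_map K K (m c) \<and> continuous_map K K (\<lambda>x. m x c)"
    and mult: "\<And>g h. g \<in> topspace Gtop \<Longrightarrow> h \<in> topspace Gtop \<Longrightarrow> m (e g) (e h) = e (gmul g h)"
    using sm by (simp_all add: sm_compactification_def)
  show "compact_space K" "compact_space K" using c by (simp_all add: compactification_def)
  have e: "e g \<in> topspace K" if "g \<in> topspace Gtop" for g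
    using continuous_map_image_subset_topspace[OF compactification_imp_continuous_map[OF c]] that
    by auto
  then show "e (g i) \<in> topspace K" "e (h j) \<in> topspace K" for i j using g h by blast+
  show "continuous_map K euclideanreal (\<lambda>x. \<bar>u (m x y) - u x\<bar>)" if "y \<in> topspace K" for y
    using continuous_map_compose[OF sep[OF that, THEN conjunct2] u] u
    by (intro continuous_map_real_abs continuous_map_diff) (simp_all add: comp_def)
  show "continuous_map K euclideanreal (\<lambda>y. \<bar>u (m x y) - u x\<bar>)" if "x \<in> topspace K" for x
    using continuous_map_compose[OF sep[OF that, THEN conjunct1] u]
    by (intro continuous_map_real_abs continuous_map_diff) (simp_all add: comp_def)
  show "\<forall>\<^sub>F i in sequentially. \<bar>u (m (e (g i)) (e (h j))) - u (e (g i))\<bar> \<le> a" for j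
    using eventually_ge_at_top[of j] by eventually_elim (simp add: mult g h le)
  show "\<forall>\<^sub>F j in sequentially. b \<le> \<bar>u (m (e (g i)) (e (h j))) - u (e (g i))\<bar>" for i
    using eventually_gt_at_top[of i] by eventually_elim (simp add: mult g h ge)
qed simp_all

lemma sm_compactification_depends_on_finite_preimage:
  fixes u :: "'k \<Rightarrow> real"
  assumes sm: "sm_compactification (perm_top :: ('a \<Rightarrow> 'a) topology) (\<circ>) K e m"
    and u: "continuous_map K euclideanreal u" and "0 < \<delta>"
  obtains F where "finite F"
    "\<And>k k'. bij k \<Longrightarrow> bij k' \<Longrightarrow> (\<And>x. k x \<in> F \<Longrightarrow> k' x = k x) \<Longrightarrow> \<bar>u (e k) - u (e k')\<bar> < \<delta>"
proof -
  note G = sm_compactification_imp_G_compactification[OF sm]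
  have e: "e k \<in> topspace K" and mult: "m (e a) (e k) = e (a \<circ> k)"
    if "bij a" "bij k" for a k :: "'a \<Rightarrow> 'a"
    using that sm
      continuous_map_image_subset_topspace[OF compactification_imp_continuous_map[of perm_top K e]]
    by (auto simp: sm_compactification_def)
  obtain U where U: "openin perm_top U" "id \<in> U"
    and small: "\<And>a y. a \<in> U \<Longrightarrow> y \<in> topspace K \<Longrightarrow> \<bar>u (m (e a) y) - u y\<bar> < \<delta>"
    using G_compactification_small_displacement[OF G, of id u \<delta>] u \<open>0 < \<delta>\<close> by auto
  obtain F where F: "finite F" "fixator F \<subseteq> U" using fixator_subset_nbhd_id[OF U] .
  show thesis
  proof (rule that[OF F(1)])
    fix k k' :: "'a \<Rightarrow> 'a" assume k: "bij k" "bij k'" "\<And>x. k x \<in> F \<Longrightarrow> k' x = k x"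
    then obtain a where a: "a \<in> fixator F" "k = a \<circ> k'" using fixator_left_factor by blast
    then have "bij a" by (simp add: fixator_def)
    with a(1) F(2) show "\<bar>u (e k) - u (e k')\<bar> < \<delta>"
      using small[of a "e k'"] e[of k' k'] mult[of a k'] k(2) by (auto simp: a(2))
  qed
qed

definition comp_upto :: "(nat \<Rightarrow> 'a \<Rightarrow> 'a) \<Rightarrow> nat \<Rightarrow> 'a \<Rightarrow> 'a" where
  "comp_upto t n = foldl (\<circ>) id (map t [0..<n])"

lemma comp_upto_0 [simp]: "comp_upto t 0 = id"
  and comp_upto_Suc [simp]: "comp_upto t (Suc n) = comp_upto t n \<circ> t n"
  by (simp_all add: comp_upto_def)

lemma bij_comp_upto: "(\<And>n. bij (t n)) \<Longrightarrow> bij (comp_upto t n)"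
  by (induction n) (simp_all add: bij_comp)

lemma comp_upto_stable:
  assumes "i \<le> j" and "\<And>k. i \<le> k \<Longrightarrow> k < j \<Longrightarrow> t k x = x"
  shows "comp_upto t j x = comp_upto t i x"
  using assms by (induction j rule: dec_induct) simp_all

lemma
  assumes A: "\<And>n. A n \<union> {x. t n x \<noteq> x} \<subseteq> A (Suc n)" and t: "\<And>n. t n \<in> fixator (A n)"
  shows comp_upto_fixes: "j \<le> i \<Longrightarrow> x \<in> A 0 \<or> x \<notin> A i \<Longrightarrow> comp_upto t j x = x"
    and comp_upto_eq_factor: "i < j \<Longrightarrow> x \<in> A (Suc i) \<Longrightarrow> t i x \<in> A 0 \<or> t i x \<notin> A i \<Longrightarrow>
      comp_upto t j x = t i x"
proof -
  have mono: "A i \<subseteq> A j" if "i \<le> j" for i j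
    using that by (rule lift_Suc_mono_le[rotated]) (use A in blast)
  have fixed_inside: "t k x = x" if "x \<in> A n" "n \<le> k" for k n x
    using t[of k] mono[OF that(2)] that(1) by (auto simp: fixator_def)
  have fixed_outside: "t k x = x" if "x \<notin> A n" "k < n" for k n x
    using A[of k] mono[of "Suc k" n] that by auto
  show fixed: "comp_upto t j x = x" if "j \<le> i" "x \<in> A 0 \<or> x \<notin> A i" for i j x
    using that comp_upto_stable[of 0 j t x] fixed_inside[of x 0] fixed_outside[of x i] by auto
  show "comp_upto t j x = t i x" if "i < j" "x \<in> A (Suc i)" "t i x \<in> A 0 \<or> t i x \<notin> A i"
  proof -
    have "comp_upto t j x = comp_upto t (Suc i) x"
      using that(1,2) by (intro comp_upto_stable) (auto intro: fixed_inside)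
    then show ?thesis using fixed[OF _ that(3)] by simp
  qed
qed

lemma finite_exhaustion_choice:
  fixes P :: "'a set \<Rightarrow> 'b \<Rightarrow> bool" and E :: "'b \<Rightarrow> 'a set"
  assumes "finite A0" and ex: "\<And>A. finite A \<Longrightarrow> \<exists>s. P A s \<and> finite (E s)"
  obtains A s where "A 0 = A0" "\<And>n::nat. A (Suc n) = A n \<union> E (s n)" "\<And>n. P (A n) (s n)"
proof -
  have "\<forall>A. \<exists>s. finite A \<longrightarrow> P A s \<and> finite (E s)" using ex by blast
  then obtain S where S: "\<And>A. finite A \<Longrightarrow> P A (S A) \<and> finite (E (S A))" by metis
  define A where "A = rec_nat A0 (\<lambda>_ A. A \<union> E (S A))"
  have A: "A 0 = A0" "A (Suc n) = A n \<union> E (S (A n))" for n by (simp_all add: A_def)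
  have "finite (A n)" for n
    by (induction n) (simp_all add: A S \<open>finite A0\<close>)
  then show thesis using that[of A "\<lambda>n. S (A n)"] A S by simp
qed

lemma escaping_pairs:
  fixes B :: "('a \<Rightarrow> 'a) \<Rightarrow> ('a \<Rightarrow> 'a) \<Rightarrow> bool"
  assumes z: "z \<in> pinj_maps" and F: "finite F"
    and B: "\<And>A. finite A \<Longrightarrow> \<exists>g t. B g t \<and> bij g \<and> graph_in A (map_option g) = graph_in A z \<and>
      t \<in> fixator A \<and> finite {x. t x \<noteq> x}"
  obtains g t :: "nat \<Rightarrow> 'a \<Rightarrow> 'a" and A :: "nat \<Rightarrow> 'a set" where
    "\<And>n. B (g n) (t n)" "\<And>n. bij (g n)" "\<And>n. t n \<in> fixator (A n)"
    "\<And>n. A n \<union> {x. t n x \<noteq> x} \<subseteq> A (Suc n)"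
    "\<And>n x. g n (t n x) \<in> F \<Longrightarrow> x \<in> A (Suc n)"
    "\<And>n x. g n x \<in> F \<Longrightarrow> x \<in> A 0 \<or> x \<notin> A n"
proof -
  define good where
    "good A = (\<lambda>(g, t). B g t \<and> bij g \<and> graph_in A (map_option g) = graph_in A z \<and> t \<in> fixator A)" for A
  let ?E = "\<lambda>(g, t). {x. t x \<noteq> x} \<union> (g \<circ> t) -` F"
  \<comment> \<open>A permutation with the same graph as \<open>z\<close> inside a set that contains \<open>F\<close> sends only the points
    of \<open>?C\<close> in that set into \<open>F\<close>.\<close>
  let ?C = "{x. z (Some x) \<in> Some ` F}"
  have base: "finite (F \<union> ?C)" using F finite_pinj_vimage[OF z F] by simp
  have step: "\<exists>s. good A s \<and> finite (?E s)" if A: "finite A" for A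
  proof -
    obtain g t where gt: "good A (g, t)" "finite {x. t x \<noteq> x}" using B[OF A] by (auto simp: good_def)
    then have "inj (g \<circ> t)" by (simp add: good_def fixator_def bij_comp bij_is_inj)
    then show ?thesis
      using gt F by (intro exI[of _ "(g, t)"]) (simp add: finite_vimageI del: vimage_comp)
  qed
  obtain A s where A_0: "A 0 = F \<union> ?C" and A_Suc: "\<And>n::nat. A (Suc n) = A n \<union> ?E (s n)"
    and good: "\<And>n. good (A n) (s n)"
    by (rule finite_exhaustion_choice[OF base, of good ?E, OF step], assumption) (rule that)
  have "x \<in> A 0 \<or> x \<notin> A n" if "fst (s n) x \<in> F" for n x
  proof (cases "x \<in> A n")
    case True
    moreover have "A 0 \<subseteq> A n" by (induction n) (auto simp: A_Suc)
    then have "fst (s n) x \<in> A n" using that by (auto simp: A_0)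
    ultimately have "z (Some x) = Some (fst (s n) x)"
      using good[of n] by (auto simp: good_def graph_in_eq_iff split_beta)
    then show ?thesis using that by (simp add: A_0)
  qed simp
  then show thesis
    using good A_Suc
    by (intro that[of "\<lambda>n. fst (s n)" "\<lambda>n. snd (s n)" A]) (auto simp: good_def split_beta)
qed

lemma escaping_sequence:
  fixes B :: "('a \<Rightarrow> 'a) \<Rightarrow> ('a \<Rightarrow> 'a) \<Rightarrow> bool"
  assumes z: "z \<in> pinj_maps" and F: "finite F"
    and B: "\<And>A. finite A \<Longrightarrow> \<exists>g t. B g t \<and> bij g \<and> graph_in A (map_option g) = graph_in A z \<and>
      t \<in> fixator A \<and> finite {x. t x \<noteq> x}"
  obtains g t h :: "nat \<Rightarrow> 'a \<Rightarrow> 'a" where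
    "\<And>i. B (g i) (t i)" "\<And>i. bij (g i)" "\<And>i. bij (t i)" "\<And>j. bij (h j)"
    "\<And>i j x. j \<le> i \<Longrightarrow> g i x \<in> F \<Longrightarrow> h j x = x"
    "\<And>i j x. i < j \<Longrightarrow> g i (t i x) \<in> F \<Longrightarrow> h j x = t i x"
proof -
  obtain g t :: "nat \<Rightarrow> 'a \<Rightarrow> 'a" and A where g: "\<And>n. B (g n) (t n)" "\<And>n. bij (g n)"
    and t: "\<And>n. t n \<in> fixator (A n)" and A: "\<And>n. A n \<union> {x. t n x \<noteq> x} \<subseteq> A (Suc n)"
    and caught: "\<And>n x. g n (t n x) \<in> F \<Longrightarrow> x \<in> A (Suc n)"
    and escapes: "\<And>n x. g n x \<in> F \<Longrightarrow> x \<in> A 0 \<or> x \<notin> A n"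
    by (rule escaping_pairs[OF z F B], assumption) (rule that)
  show thesis
  proof (rule that[of g t "comp_upto t"])
    show "B (g i) (t i)" "bij (g i)" "bij (t i)" for i
      using g t by (simp_all add: fixator_def)
    then show "bij (comp_upto t j)" for j by (intro bij_comp_upto)
    show "comp_upto t j x = x" if "j \<le> i" "g i x \<in> F" for i j x
      by (rule comp_upto_fixes[OF A t that(1) escapes[OF that(2)]])
    show "comp_upto t j x = t i x" if "i < j" "g i (t i x) \<in> F" for i j x
      by (rule comp_upto_eq_factor[OF A t that(1) caught[OF that(2)] escapes[OF that(2)]])
  qed
qed

lemma large_oscillation_imp_large_translation:
  fixes f :: "('a \<Rightarrow> 'a) \<Rightarrow> real"
  assumes F: "finite F"
    and close: "\<And>k k'. bij k \<Longrightarrow> bij k' \<Longrightarrow> (\<And>x. k x \<in> F \<Longrightarrow> k' x = k x) \<Longrightarrow> \<bar>f k - f k'\<bar> < \<delta>"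
    and large: "\<And>A. finite A \<Longrightarrow> \<exists>g g'. bij g \<and> bij g' \<and> graph_in A (map_option g) = graph_in A z \<and>
      graph_in A (map_option g') = graph_in A z \<and> \<epsilon> < \<bar>f g - f g'\<bar>"
    and A: "finite A"
  shows "\<exists>g t. \<epsilon> - \<delta> \<le> \<bar>f (g \<circ> t) - f g\<bar> \<and> bij g \<and> graph_in A (map_option g) = graph_in A z \<and>
    t \<in> fixator A \<and> finite {x. t x \<noteq> x}"
proof -
  have fin: "finite (A \<union> F)" using A F by simp
  obtain g g' where g: "bij g" "bij g'"
    and graph: "graph_in (A \<union> F) (map_option g) = graph_in (A \<union> F) z"
      "graph_in (A \<union> F) (map_option g') = graph_in (A \<union> F) z"
    and far: "\<epsilon> < \<bar>f g - f g'\<bar>"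
    using large[OF fin] by blast
  obtain t where t: "t \<in> fixator (A \<union> F)" "finite {x. t x \<noteq> x}"
    "\<And>x. g' x \<in> A \<union> F \<Longrightarrow> g (t x) = g' x"
    by (rule graph_in_eq_imp_translate[OF fin g]) (use graph in simp, rule that)
  then have "bij t" "t \<in> fixator A" by (auto simp: fixator_def)
  then have "\<bar>f g' - f (g \<circ> t)\<bar> < \<delta>"
    using g t(3) by (intro close) (auto intro: bij_comp)
  then have "\<epsilon> - \<delta> \<le> \<bar>f (g \<circ> t) - f g\<bar>" using far by linarith
  moreover have "graph_in A (map_option g) = graph_in A z" using graph(1) by (simp add: graph_in_eq_iff)
  ultimately show ?thesis using g(1) \<open>t \<in> fixator A\<close> t(2) by blast
qed

lemma sm_compactification_small_oscillation:
  fixes u :: "'k \<Rightarrow> real"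
  assumes sm: "sm_compactification (perm_top :: ('a \<Rightarrow> 'a) topology) (\<circ>) K e m"
    and u: "continuous_map K euclideanreal u" and "0 < \<epsilon>" and z: "z \<in> pinj_maps"
  shows "\<exists>A. finite A \<and> (\<forall>g g'. bij g \<longrightarrow> bij g' \<longrightarrow> graph_in A (map_option g) = graph_in A z \<longrightarrow>
    graph_in A (map_option g') = graph_in A z \<longrightarrow> \<bar>u (e g) - u (e g')\<bar> \<le> \<epsilon>)"
proof (rule ccontr)
  assume "\<not> ?thesis"
  then have large: "\<exists>g g'. bij g \<and> bij g' \<and> graph_in A (map_option g) = graph_in A z \<and>
      graph_in A (map_option g') = graph_in A z \<and> \<epsilon> < \<bar>u (e g) - u (e g')\<bar>" if "finite A" for A
    using that by (meson not_le)
  have "0 < \<epsilon> / 4" using \<open>0 < \<epsilon>\<close> by simp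
  then obtain F where F: "finite F" and close:
    "\<And>k k'. bij k \<Longrightarrow> bij k' \<Longrightarrow> (\<And>x. k x \<in> F \<Longrightarrow> k' x = k x) \<Longrightarrow> \<bar>u (e k) - u (e k')\<bar> < \<epsilon> / 4"
    using sm_compactification_depends_on_finite_preimage[OF sm u] by blast
  note large_translation = large_oscillation_imp_large_translation[OF F close large]
  obtain g t h :: "nat \<Rightarrow> 'a \<Rightarrow> 'a"
    where far: "\<And>i. \<epsilon> - \<epsilon> / 4 \<le> \<bar>u (e (g i \<circ> t i)) - u (e (g i))\<bar>"
      and bij: "\<And>i. bij (g i)" "\<And>i. bij (t i)" "\<And>j. bij (h j)"
      and late: "\<And>i j x. j \<le> i \<Longrightarrow> g i x \<in> F \<Longrightarrow> h j x = x"
      and early: "\<And>i j x. i < j \<Longrightarrow> g i (t i x) \<in> F \<Longrightarrow> h j x = t i x"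
    by (rule escaping_sequence[OF z F large_translation], assumption+) (rule that)
  have "\<epsilon> / 2 \<le> \<epsilon> / 4"
  proof (rule sm_compactification_double_limit[OF sm u, of g h])
    show "\<bar>u (e (g i \<circ> h j)) - u (e (g i))\<bar> \<le> \<epsilon> / 4" if "j \<le> i" for i j
      using close[of "g i" "g i \<circ> h j"] bij late[OF that]
      by (simp add: bij_comp abs_minus_commute less_imp_le)
    show "\<epsilon> / 2 \<le> \<bar>u (e (g i \<circ> h j)) - u (e (g i))\<bar>" if "i < j" for i j
    proof -
      have "\<bar>u (e (g i \<circ> t i)) - u (e (g i \<circ> h j))\<bar> < \<epsilon> / 4"
        using bij early[OF that] by (intro close) (simp_all add: bij_comp)
      then show ?thesis using far[of i] by linarith
    qed
  qed (use bij in simp_all)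
  with \<open>0 < \<epsilon>\<close> show False by simp
qed

lemma sm_compactification_quotient_of_pinj_top:
  assumes inf: "infinite (UNIV :: 'a set)"
    and sm: "sm_compactification (perm_top :: ('a \<Rightarrow> 'a) topology) (\<circ>) K e m"
  shows "\<exists>h. continuous_map pinj_top K h \<and> (\<forall>g\<in>topspace perm_top. h (map_option g) = e g)"
proof -
  let ?S = "map_option ` {g :: 'a \<Rightarrow> 'a. bij g}"
    and ?f = "\<lambda>f :: 'a option \<Rightarrow> 'a option. e (\<lambda>x. the (f (Some x)))"
  have c: "compactification perm_top K e" using sm by (simp add: sm_compactification_def)
  have f: "continuous_map (subtopology pinj_top ?S) K ?f"
    using homeomorphic_maps_perm_top continuous_map_compose[OF _ compactification_imp_continuous_map[OF c]]
    by (fastforce simp: homeomorphic_maps_def comp_def)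
  obtain h where "continuous_map pinj_top K h" "\<And>x. x \<in> ?S \<Longrightarrow> h x = ?f x"
  proof (rule continuous_map_extension_if_small_oscillation[OF _ _ _ _ f])
    show "compact_space K" "Hausdorff_space K" using c by (simp_all add: compactification_def)
    show "?S \<subseteq> topspace pinj_top" using map_option_pinj by auto
    show "pinj_top closure_of ?S = topspace pinj_top" by (simp add: closure_of_permutations[OF inf])
    fix z and u :: "_ \<Rightarrow> real" and \<epsilon> :: real
    assume z: "z \<in> topspace pinj_top - ?S" and u: "continuous_map K euclideanreal u" "0 < \<epsilon>"
    then obtain F where F: "finite F" and small: "\<And>g g'. bij g \<Longrightarrow> bij g' \<Longrightarrow>
        graph_in F (map_option g) = graph_in F z \<Longrightarrow> graph_in F (map_option g') = graph_in F z \<Longrightarrow>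
        \<bar>u (e g) - u (e g')\<bar> \<le> \<epsilon>"
      using sm_compactification_small_oscillation[OF sm u, of z] by auto
    let ?V = "{f \<in> pinj_maps. graph_in F f = graph_in F z}"
    have "\<bar>u (?f a) - u (?f b)\<bar> \<le> \<epsilon>" if "a \<in> ?V \<inter> ?S" "b \<in> ?V \<inter> ?S" for a b
      using that small by auto
    then show "\<exists>V. openin pinj_top V \<and> z \<in> V \<and> (\<forall>a\<in>V \<inter> ?S. \<forall>b\<in>V \<inter> ?S. \<bar>u (?f a) - u (?f b)\<bar> \<le> \<epsilon>)"
      using z openin_graph_in[OF F] by (intro exI[of _ ?V]) simp
  qed blast
  then show ?thesis by (intro exI[of _ h]) simp
qed

theorem mainTheorem8:
  assumes X_inf: "infinite (UNIV :: 'a set)"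
  shows
   \<comment> \<open>(a)\<close>
   "(G_compactification (perm_top :: ('a \<Rightarrow> 'a) topology) (\<lambda>g x. g x) (discrete_topology UNIV)
        alphaX Some (\<lambda>g. map_option g)
     \<and> (\<forall>(K :: 'k topology) e \<alpha>.
          G_compactification (perm_top :: ('a \<Rightarrow> 'a) topology) (\<lambda>g x. g x) (discrete_topology UNIV) K e \<alpha>
          \<longrightarrow> equiv_compactification (discrete_topology UNIV) alphaX Some K e))
   \<comment> \<open>(b)\<close>
   \<and> roelcke_compactification (perm_top :: ('a \<Rightarrow> 'a) topology) (\<circ>) id
        (env_top alphaX (\<lambda>g. map_option g) (topspace perm_top))
        (env_map alphaX (\<lambda>g. map_option g))
   \<and> roelcke_precompact (perm_top :: ('a \<Rightarrow> 'a) topology) (\<circ>) id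
   \<comment> \<open>(c)\<close>
   \<and> roelcke_compactification (perm_top :: ('a \<Rightarrow> 'a) topology) (\<circ>) id
        (subtopology (product_topology (\<lambda>_. alphaX) UNIV) pinj_maps) (\<lambda>g. map_option g)
   \<comment> \<open>(d)\<close>
   \<and> sim_compactification (perm_top :: ('a \<Rightarrow> 'a) topology) (\<circ>)
        (env_top alphaX (\<lambda>g. map_option g) (topspace perm_top))
        (env_map alphaX (\<lambda>g. map_option g)) (\<circ>)
   \<and> (\<exists>\<phi>. monoid_iso_to_IX (topspace (env_top (alphaX :: 'a option topology) (\<lambda>g. map_option g) (topspace perm_top)))
            (\<circ>) (UNIV :: 'a set) \<phi>)
   \<and> (\<forall>(K :: 'l topology) e m.
        sm_compactification (perm_top :: ('a \<Rightarrow> 'a) topology) (\<circ>) K e m \<longrightarrow>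
        (\<exists>h. continuous_map (env_top alphaX (\<lambda>g. map_option g) (topspace perm_top)) K h
             \<and> (\<forall>g\<in>topspace perm_top. h (env_map alphaX (\<lambda>g. map_option g) g) = e g)))"
proof -
  show ?thesis
    unfolding env_top_alphaX[OF X_inf] env_map_alphaX pinj_top_def[symmetric] topspace_pinj_top
    by (intro conjI allI impI exI[of _ "\<lambda>f. f \<circ> Some"] G_compactification_alphaX[OF X_inf]
        G_compactification_discrete_unique[OF X_inf] roelcke_compactification_pinj_top[OF X_inf]
        roelcke_precompact_perm_top sim_compactification_pinj_top[OF X_inf] monoid_iso_pinj_maps
        sm_compactification_quotient_of_pinj_top[OF X_inf])
qed


end
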